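(* Let $k \ge 1$ be an integer, and let $X$ and $Y$ be strings of lengths $m$ and $n$ respectively over a totally ordered alphabet, with $n\ge m$. The length of a longest common subsequence in at least $k$ length order-isomorphic substrings (an op-LCS$_{k^+}$) of $X$ and $Y$ can be computed in $O(mn)$ time and $O(mn)$ space.
   Context: Two strings $S,T$ of the same length $l$ over a totally ordered alphabet are order-isomorphic, written $S\approx T$, if for all $1\le i,j\le l$: $S[i]\le S[j]\iff T[i]\le T[j]$. For a string $X$, $X[i..l]$ denotes the substring $X[i]X[i+1]\cdots X[i+l-1]$. Given strings $X$ (length $m$), $Y$ (length $n$) and an integer $k\ge 1$, a string $Z$ is a common subsequence in at least $k$ length order-isomorphic substrings of $X$ and $Y$ if there exist $t\ge 0$, indices $i_1,\dots,i_t$, $j_1,\dots,j_t$, $p_1,\dots,p_t$ and lengths $l_1,\dots,l_t$ such that for all $1\le s\le t$: $l_s\ge k$ and $X[i_s..l_s]\approx Y[j_s..l_s]\approx Z[p_s..l_s]$; for $1\le s<t$: $i_s+l_s\le i_{s+1}$, $j_s+l_s\le j_{s+1}$, $p_{s+1}=p_s+l_s$; and $p_1=1$, $|Z|=p_t+l_t-1$. (It is not required that the concatenations of the chosen pieces of $X$ and of $Y$ be order-isomorphic to each other.) An op-LCS$_{k^+}$ is such a $Z$ of maximum length. Complexities are in the RAM model where comparing two alphabet symbols takes constant time. *)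

theory Defs
  imports Main
begin

section \<open>Common subsequences in order-isomorphic substrings\<close>

text \<open>
  The totally ordered alphabet is a carrier set \<open>A\<close> with an order relation \<open>r\<close> such that
  \<open>linear_order_on A r\<close>; strings are elements of \<open>lists A\<close>. Keeping the order explicit (rather
  than using a type class) allows a single program and a single constant to serve all ordered
  alphabets inside the type.
\<close>

definition order_iso :: "'a rel \<Rightarrow> 'a list \<Rightarrow> 'a list \<Rightarrow> bool" where
  "order_iso r S T \<longleftrightarrow> length S = length T \<and>
     (\<forall>i<length S. \<forall>j<length S. (S ! i, S ! j) \<in> r \<longleftrightarrow> (T ! i, T ! j) \<in> r)"

text \<open>\<open>substr X i l\<close> is the substring of length \<open>l\<close> starting at the 1-based position \<open>i\<close>; it
  exists iff \<open>has_substr X i l\<close>.\<close>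

definition substr :: "'a list \<Rightarrow> nat \<Rightarrow> nat \<Rightarrow> 'a list" where
  "substr X i l = take l (drop (i - 1) X)"

definition has_substr :: "'a list \<Rightarrow> nat \<Rightarrow> nat \<Rightarrow> bool" where
  "has_substr X i l \<longleftrightarrow> 1 \<le> i \<and> i + l \<le> length X + 1"

text \<open>For \<open>t = 0\<close> there are no pieces, so \<open>Z\<close> is the empty string.\<close>

definition op_common_subseq ::
    "'a rel \<Rightarrow> nat \<Rightarrow> 'a list \<Rightarrow> 'a list \<Rightarrow> 'a list \<Rightarrow> bool" where
  "op_common_subseq r k X Y Z \<longleftrightarrow>
    (\<exists>(t::nat) (i::nat \<Rightarrow> nat) (j::nat \<Rightarrow> nat) (p::nat \<Rightarrow> nat) (l::nat \<Rightarrow> nat).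
      (\<forall>s\<in>{1..t}. k \<le> l s \<and>
         has_substr X (i s) (l s) \<and> has_substr Y (j s) (l s) \<and> has_substr Z (p s) (l s) \<and>
         order_iso r (substr X (i s) (l s)) (substr Y (j s) (l s)) \<and>
         order_iso r (substr Y (j s) (l s)) (substr Z (p s) (l s))) \<and>
      (\<forall>s\<in>{1..<t}. i s + l s \<le> i (s + 1) \<and> j s + l s \<le> j (s + 1) \<and> p (s + 1) = p s + l s) \<and>
      (if t = 0 then Z = [] else p 1 = 1 \<and> length Z = p t + l t - 1))"

definition is_op_LCS ::
    "'a set \<Rightarrow> 'a rel \<Rightarrow> nat \<Rightarrow> 'a list \<Rightarrow> 'a list \<Rightarrow> 'a list \<Rightarrow> bool" where
  "is_op_LCS A r k X Y Z \<longleftrightarrow>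
     Z \<in> lists A \<and> op_common_subseq r k X Y Z \<and>
     (\<forall>Z'\<in>lists A. op_common_subseq r k X Y Z' \<longrightarrow> length Z' \<le> length Z)"


section \<open>Random access machine with symbol comparisons\<close>

text \<open>
  A program is a finite instruction list, executed at one time unit per instruction. The memory
  is an array of natural numbers with direct and indirect addressing. The symbols of the input
  are kept in a separate read-only array \<open>w\<close> and can be inspected only through \<open>Leq\<close>, which
  compares two symbols whose positions are given by memory cells; in particular, programs do not
  depend on the alphabet. Below, \<open>M\<close> is the memory:

  \<^item> \<open>Const d n\<close>: \<open>M[d] := n\<close>
  \<^item> \<open>Add d a b\<close>, \<open>Sub d a b\<close>, \<open>Mul d a b\<close>: arithmetic on \<open>M[a]\<close>, \<open>M[b]\<close> (truncated subtraction)
  \<^item> \<open>Load d a\<close>: \<open>M[d] := M[M[a]]\<close>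
  \<^item> \<open>Store a b\<close>: \<open>M[M[a]] := M[b]\<close>
  \<^item> \<open>Leq d a b\<close>: \<open>M[d] := 1\<close> if the symbol at position \<open>M[a]\<close> is at most the one at position
    \<open>M[b]\<close>, and \<open>M[d] := 0\<close> otherwise (also if a position is out of range)
  \<^item> \<open>JmpLe a b q\<close>: continue at instruction \<open>q\<close> if \<open>M[a] \<le> M[b]\<close>

  The machine halts when the program counter leaves the program.
\<close>

datatype instr =
    Const nat nat
  | Add nat nat nat
  | Sub nat nat nat
  | Mul nat nat nat
  | Load nat nat
  | Store nat nat
  | Leq nat nat nat
  | JmpLe nat nat nat

type_synonym memory = "nat \<Rightarrow> nat"
type_synonym config = "nat \<times> memory"

fun sym_leq :: "'a rel \<Rightarrow> 'a list \<Rightarrow> nat \<Rightarrow> nat \<Rightarrow> bool" where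
  "sym_leq r w x y \<longleftrightarrow> x < length w \<and> y < length w \<and> (w ! x, w ! y) \<in> r"

fun exec :: "'a rel \<Rightarrow> 'a list \<Rightarrow> instr \<Rightarrow> config \<Rightarrow> config" where
  "exec r w (Const d n) (pc, M) = (pc + 1, M(d := n))"
| "exec r w (Add d a b) (pc, M) = (pc + 1, M(d := M a + M b))"
| "exec r w (Sub d a b) (pc, M) = (pc + 1, M(d := M a - M b))"
| "exec r w (Mul d a b) (pc, M) = (pc + 1, M(d := M a * M b))"
| "exec r w (Load d a) (pc, M) = (pc + 1, M(d := M (M a)))"
| "exec r w (Store a b) (pc, M) = (pc + 1, M(M a := M b))"
| "exec r w (Leq d a b) (pc, M) = (pc + 1, M(d := (if sym_leq r w (M a) (M b) then 1 else 0)))"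
| "exec r w (JmpLe a b q) (pc, M) = (if M a \<le> M b then q else pc + 1, M)"

fun accessed :: "instr \<Rightarrow> memory \<Rightarrow> nat set" where
  "accessed (Const d n) M = {d}"
| "accessed (Add d a b) M = {d, a, b}"
| "accessed (Sub d a b) M = {d, a, b}"
| "accessed (Mul d a b) M = {d, a, b}"
| "accessed (Load d a) M = {d, a, M a}"
| "accessed (Store a b) M = {a, b, M a}"
| "accessed (Leq d a b) M = {d, a, b}"
| "accessed (JmpLe a b q) M = {a, b}"

definition halted :: "instr list \<Rightarrow> config \<Rightarrow> bool" where
  "halted P cf \<longleftrightarrow> length P \<le> fst cf"

definition step :: "instr list \<Rightarrow> 'a rel \<Rightarrow> 'a list \<Rightarrow> config \<Rightarrow> config" where
  "step P r w cf = (if halted P cf then cf else exec r w (P ! fst cf) cf)"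

definition step_cells :: "instr list \<Rightarrow> config \<Rightarrow> nat set" where
  "step_cells P cf = (if halted P cf then {} else accessed (P ! fst cf) (snd cf))"

text \<open>Numeric inputs are in the first memory cells; all other cells are initially 0.\<close>

definition init_config :: "nat list \<Rightarrow> config" where
  "init_config ns = (0, \<lambda>a. if a < length ns then ns ! a else 0)"

definition config_at ::
    "instr list \<Rightarrow> 'a rel \<Rightarrow> 'a list \<Rightarrow> nat list \<Rightarrow> nat \<Rightarrow> config" where
  "config_at P r w ns s = (step P r w ^^ s) (init_config ns)"

text \<open>
  \<open>ram_computes P r w ns out time space word\<close>: on symbol input \<open>w\<close> and numeric input \<open>ns\<close>,
  program \<open>P\<close> halts after at most \<open>time\<close> steps with \<open>out\<close> in cell 0, reads or writes at most
  \<open>space\<close> distinct memory cells, and never holds a number \<open>\<ge> word\<close> in memory. The last condition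
  is the usual bounded word length, without which unit-cost arithmetic would be unrealistic.
\<close>

definition ram_computes ::
    "instr list \<Rightarrow> 'a rel \<Rightarrow> 'a list \<Rightarrow> nat list \<Rightarrow> nat \<Rightarrow> nat \<Rightarrow> nat \<Rightarrow> nat \<Rightarrow> bool" where
  "ram_computes P r w ns out time space word \<longleftrightarrow>
    (\<exists>t\<le>time.
       halted P (config_at P r w ns t) \<and>
       snd (config_at P r w ns t) 0 = out \<and>
       card (\<Union>s<t. step_cells P (config_at P r w ns s)) \<le> space \<and>
       (\<forall>s\<le>t. \<forall>a. snd (config_at P r w ns s) a < word))"

end

theory Submission
  imports Defs
begin

text \<open>
  Order isomorphism of substrings is inherited by prefixes and suffixes, so for prefix lengths \<open>i\<close>
  and \<open>j\<close> there is a longest length \<open>iso_len i j\<close> of order-isomorphic pieces ending there, and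
  \<open>opt i j\<close> is the maximum of \<open>opt (i-1) j\<close>, \<open>opt i (j-1)\<close> and all \<open>opt (i-l) (j-l) + l\<close> with
  \<open>k \<le> l \<le> iso_len i j\<close>. Both ingredients take amortised constant time along each diagonal. To extend an
  isomorphism by one symbol it suffices to compare the new symbol with its predecessor and successor
  among the earlier symbols of the piece of \<open>X\<close>; these neighbours are tabulated for each end position
  in time \<open>O(m)\<close>. Since \<open>iso_len (i+1) (j+1) \<le> iso_len i j + 1\<close>, a two-pointer scan finds all lengths. The
  maximum over \<open>l\<close> ranges over a window of the diagonal both of whose ends move forward; it is
  maintained by a queue made of two stacks, one storing suffix maxima and the other only its overall
  maximum. The pointer positions telescope along the diagonals, which bounds the total work by a
  multiple of \<open>m (m + n)\<close>.
\<close>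

section \<open>Structured programs for the random access machine\<close>

text \<open>The amortisation runs along diagonals, but \<open>opt\<close> also needs the neighbours
  \<open>(i-1, j)\<close> and \<open>(i, j-1)\<close>, so cells are visited row by row and the scans
  and queues of all diagonals are in progress at once. Their states therefore live in tables, and a
  cell inherits the state of its diagonal predecessor. Two stacks are used because a maximum, unlike
  a sum, cannot be corrected when an element leaves. Where the stacks meet is the one part of the
  queue state that the window does not determine; the recursive function \<open>split_row\<close> of
  the cell fixes it, so table contents and costs can be stated without the history of the run. Two
  potentials pay for all non-constant work inside a cell: the first row
  \<open>i - iso_len i j\<close> of the window and \<open>split_row i j\<close>. Both are at most
  \<open>m\<close> and never decrease along a diagonal. The assumption \<open>m \<le> n\<close>
  enters in the absorption of \<open>m * m\<close> into \<open>m * n\<close> and in the storage of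
  tables over positions of \<open>X\<close> in a row with \<open>n + 1\<close> columns.\<close>

datatype com =
    Op instr
  | Seq com com (infixr \<open>;;\<close> 60)
  | If_Le nat nat com com
  | While_Le nat nat com

primrec code_len :: "com \<Rightarrow> nat" where
  "code_len (Op x) = 1"
| "code_len (c1 ;; c2) = code_len c1 + code_len c2"
| "code_len (If_Le a b c1 c2) = code_len c1 + code_len c2 + 2"
| "code_len (While_Le a b c) = code_len c + 3"

primrec compile :: "com \<Rightarrow> nat \<Rightarrow> instr list" where
  "compile (Op x) q = [x]"
| "compile (c1 ;; c2) q = compile c1 q @ compile c2 (q + code_len c1)"
| "compile (If_Le a b c1 c2) q =
     JmpLe a b (q + code_len c2 + 2) # compile c2 (q + 1) @
     JmpLe 0 0 (q + code_len c1 + code_len c2 + 2) # compile c1 (q + code_len c2 + 2)"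
| "compile (While_Le a b c) q =
     JmpLe a b (q + 2) # JmpLe 0 0 (q + code_len c + 3) # compile c (q + 2) @ [JmpLe 0 0 q]"

lemma length_compile [simp]: "length (compile c q) = code_len c"
  by (induction c arbitrary: q) auto

fun op_ok :: "instr \<Rightarrow> bool" where
  "op_ok (Const d n) \<longleftrightarrow> d < 64 \<and> n < 128"
| "op_ok (Add d a b) \<longleftrightarrow> d < 64 \<and> a < 64 \<and> b < 64"
| "op_ok (Sub d a b) \<longleftrightarrow> d < 64 \<and> a < 64 \<and> b < 64"
| "op_ok (Mul d a b) \<longleftrightarrow> d < 64 \<and> a < 64 \<and> b < 64"
| "op_ok (Load d a) \<longleftrightarrow> d < 64 \<and> a < 64"
| "op_ok (Store a b) \<longleftrightarrow> a < 64 \<and> b < 64"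
| "op_ok (Leq d a b) \<longleftrightarrow> d < 64 \<and> a < 64 \<and> b < 64"
| "op_ok (JmpLe a b q) \<longleftrightarrow> False"

primrec com_ok :: "com \<Rightarrow> bool" where
  "com_ok (Op x) \<longleftrightarrow> op_ok x"
| "com_ok (c1 ;; c2) \<longleftrightarrow> com_ok c1 \<and> com_ok c2"
| "com_ok (If_Le a b c1 c2) \<longleftrightarrow> a < 64 \<and> b < 64 \<and> com_ok c1 \<and> com_ok c2"
| "com_ok (While_Le a b c) \<longleftrightarrow> a < 64 \<and> b < 64 \<and> com_ok c"

definition code_at :: "instr list \<Rightarrow> nat \<Rightarrow> instr list \<Rightarrow> bool" where
  "code_at P q L \<longleftrightarrow> (\<exists>B C. P = B @ L @ C \<and> length B = q)"

lemma code_at_append: "code_at P q (L1 @ L2) \<Longrightarrow> code_at P q L1 \<and> code_at P (q + length L1) L2"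
  unfolding code_at_def
  by (metis append.assoc length_append)

lemma code_at_Cons: "code_at P q (x # L) \<Longrightarrow> q < length P \<and> P ! q = x \<and> code_at P (Suc q) L"
  unfolding code_at_def
  by (clarsimp simp: nth_append) (metis append.assoc append_Cons append_Nil length_append_singleton)

text \<open>An opaque 0/1 value: simplification of straight-line code does not split it into cases,
  and \<open>flag_simps\<close> turns truncated subtraction and \<open>max\<close> into Boolean
  operations.\<close>

definition flag :: "bool \<Rightarrow> nat" where
  "flag b = (if b then 1 else 0)"

lemma flag_simps [simp]:
  "Suc 0 - flag b = flag (\<not> b)" "flag a - flag b = flag (a \<and> \<not> b)"
  "max (flag a) (flag b) = flag (a \<or> b)" "Suc 0 \<le> flag b \<longleftrightarrow> b"
  by (auto simp: flag_def)

locale ram =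
  fixes r :: "'a rel" and w :: "'a list" and N W :: nat
  assumes N64: "64 \<le> N" and W128: "128 \<le> W"
begin

text \<open>Only \<open>Add\<close> and \<open>Mul\<close> can produce a number beyond the word
  bound, and only \<open>Load\<close> and \<open>Store\<close> can reach a cell that is not a fixed
  register. Constants and direct addresses are bounded by \<open>op_ok\<close>.\<close>

fun vc_op :: "instr \<Rightarrow> (memory \<Rightarrow> nat \<Rightarrow> bool) \<Rightarrow> memory \<Rightarrow> nat \<Rightarrow> bool" where
  "vc_op (Const d n) Q M t \<longleftrightarrow> Q (M(d := n)) (t + 1)"
| "vc_op (Add d a b) Q M t \<longleftrightarrow> M a + M b < W \<and> Q (M(d := M a + M b)) (t + 1)"
| "vc_op (Sub d a b) Q M t \<longleftrightarrow> Q (M(d := M a - M b)) (t + 1)"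
| "vc_op (Mul d a b) Q M t \<longleftrightarrow> M a * M b < W \<and> Q (M(d := M a * M b)) (t + 1)"
| "vc_op (Load d a) Q M t \<longleftrightarrow> M a < N \<and> Q (M(d := M (M a))) (t + 1)"
| "vc_op (Store a b) Q M t \<longleftrightarrow> M a < N \<and> Q (M(M a := M b)) (t + 1)"
| "vc_op (Leq d a b) Q M t \<longleftrightarrow> Q (M(d := flag (sym_leq r w (M a) (M b)))) (t + 1)"
| "vc_op (JmpLe a b q) Q M t \<longleftrightarrow> False"

text \<open>The time counter \<open>t\<close> is part of the state: a loop invariant that bounds it by some \<open>B\<close>
  also proves termination, so that amortised running times need no separate variant.\<close>

primrec vc :: "com \<Rightarrow> (memory \<Rightarrow> nat \<Rightarrow> bool) \<Rightarrow> memory \<Rightarrow> nat \<Rightarrow> bool" where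
  "vc (Op x) Q M t \<longleftrightarrow> vc_op x Q M t"
| "vc (c1 ;; c2) Q M t \<longleftrightarrow> vc c1 (vc c2 Q) M t"
| "vc (If_Le a b c1 c2) Q M t \<longleftrightarrow>
     (if M a \<le> M b then vc c1 Q M (t + 2) else vc c2 Q M (t + 2))"
| "vc (While_Le a b c) Q M t \<longleftrightarrow>
     (\<exists>I B. I M t \<and> (\<forall>M t. I M t \<longrightarrow> t \<le> B \<and>
        (if M a \<le> M b then vc c I M (t + 2) else Q M (t + 2))))"

lemma vc_op_mono: "vc_op x Q M t \<Longrightarrow> (\<And>M t. Q M t \<Longrightarrow> Q' M t) \<Longrightarrow> vc_op x Q' M t"
  by (cases x) auto

lemma vc_mono: "vc c Q M t \<Longrightarrow> (\<And>M t. Q M t \<Longrightarrow> Q' M t) \<Longrightarrow> vc c Q' M t"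
proof (induction c arbitrary: Q Q' M t)
  case (Op x)
  then show ?case using vc_op_mono[of x Q M t Q'] by simp
next
  case (Seq c1 c2)
  then show ?case by (metis vc.simps(2))
next
  case (If_Le a b c1 c2)
  then show ?case by (metis vc.simps(3))
next
  case (While_Le a b c)
  then obtain I B where "I M t"
    "\<forall>M t. I M t \<longrightarrow> t \<le> B \<and> (if M a \<le> M b then vc c I M (t + 2) else Q M (t + 2))"
    by auto
  then show ?case
    using While_Le.prems(2) unfolding vc.simps
    by (intro exI[of _ I] exI[of _ B] conjI) meson+
qed

lemma vc_WhileI:
  assumes "I M t"
    and "\<And>M t. I M t \<Longrightarrow> t \<le> B"
    and "\<And>M t. I M t \<Longrightarrow> M a \<le> M b \<Longrightarrow> vc c I M (t + 2)"
    and "\<And>M t. I M t \<Longrightarrow> \<not> M a \<le> M b \<Longrightarrow> Q M (t + 2)"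
  shows "vc (While_Le a b c) Q M t"
  unfolding vc.simps using assms by (intro exI[of _ I] exI[of _ B] conjI) meson+

section \<open>Soundness of the verification conditions for compiled code\<close>

definition word_ok :: "memory \<Rightarrow> bool" where
  "word_ok M \<longleftrightarrow> (\<forall>a. M a < W)"

inductive run :: "instr list \<Rightarrow> config \<Rightarrow> nat \<Rightarrow> config \<Rightarrow> bool" for P where
  run_0: "word_ok (snd cf) \<Longrightarrow> run P cf 0 cf"
| run_Suc: "word_ok (snd cf) \<Longrightarrow> step_cells P cf \<subseteq> {..<N} \<Longrightarrow>
    run P (step P r w cf) n cf' \<Longrightarrow> run P cf (Suc n) cf'"

lemma run_trans: "run P cf n cf' \<Longrightarrow> run P cf' n' cf'' \<Longrightarrow> run P cf (n + n') cf''"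
  by (induction rule: run.induct) (auto intro: run.intros)

lemma run_word_ok: "run P cf n cf' \<Longrightarrow> word_ok (snd cf')"
  by (induction rule: run.induct) auto

lemma run_funpow:
  assumes "run P cf n cf'"
  shows "(step P r w ^^ n) cf = cf'"
    and "s < n \<Longrightarrow> step_cells P ((step P r w ^^ s) cf) \<subseteq> {..<N}"
    and "s \<le> n \<Longrightarrow> word_ok (snd ((step P r w ^^ s) cf))"
  using assms
proof (induction arbitrary: s rule: run.induct)
  case (run_0 cf)
  {
    case 1 show ?case by simp
  next
    case 2 then show ?case by simp
  next
    case 3 then show ?case using run_0 by simp
  }
next
  case (run_Suc cf n cf')
  {
    case 1 show ?case using run_Suc.IH(1) by (simp add: funpow_swap1)
  next
    case 2 then show ?case
      using run_Suc by (cases s) (auto simp: funpow_swap1)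
  next
    case 3 then show ?case
      using run_Suc by (cases s) (auto simp: funpow_swap1)
  }
qed

lemma run_jump:
  assumes "code_at P q (JmpLe a b q' # L)" "word_ok M" "a < 64" "b < 64"
  shows "run P (q, M) 1 (if M a \<le> M b then q' else Suc q, M)"
proof -
  have "q < length P" "P ! q = JmpLe a b q'"
    using code_at_Cons[OF assms(1)] by auto
  then have s: "step P r w (q, M) = (if M a \<le> M b then q' else Suc q, M)"
    and c: "step_cells P (q, M) \<subseteq> {..<N}"
    using assms N64 by (auto simp: step_def step_cells_def halted_def)
  show ?thesis
    using run_Suc[of "(q, M)" P 0] run_0[of "(if M a \<le> M b then q' else Suc q, M)" P] s c assms
    by (simp split: if_splits)
qed

lemma vc_op_sound:
  assumes "vc_op x Q M t" "word_ok M" "op_ok x" "code_at P q [x]"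
  shows "\<exists>M'. run P (q, M) 1 (Suc q, M') \<and> Q M' (t + 1)"
proof -
  have q: "q < length P" "P ! q = x"
    using code_at_Cons[of P q x "[]"] assms by auto
  have c: "step_cells P (q, M) \<subseteq> {..<N}"
    using assms q N64 by (cases x) (auto simp: step_cells_def halted_def)
  have "\<exists>M'. step P r w (q, M) = (Suc q, M') \<and> word_ok M' \<and> Q M' (t + 1)"
    using assms q W128 by (cases x) (auto simp: step_def halted_def word_ok_def less_imp_diff_less
        flag_def simp del: sym_leq.simps)
  then show ?thesis
    using run_Suc[of "(q, M)" P 0] run_0 c assms by fastforce
qed

text \<open>The counter dominates the number of steps because the 2 units charged for a test pay for
  its jump and for the jump that skips the other branch, closes the iteration or leaves the
  loop.\<close>

lemma vc_sound:
  assumes "vc c Q M t" "word_ok M" "com_ok c" "code_at P q (compile c q)"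
  shows "\<exists>n t' M'. run P (q, M) n (q + code_len c, M') \<and> t + n \<le> t' \<and> Q M' t'"
  using assms
proof (induction c arbitrary: Q M t q)
  case (Op x)
  then show ?case using vc_op_sound[of x Q M t P q] by fastforce
next
  case (Seq c1 c2)
  have c: "code_at P q (compile c1 q)" "code_at P (q + code_len c1) (compile c2 (q + code_len c1))"
    using Seq.prems(4) code_at_append[of P q "compile c1 q" "compile c2 (q + code_len c1)"] by auto
  obtain n t' M' where 1: "run P (q, M) n (q + code_len c1, M')" "t + n \<le> t'" "vc c2 Q M' t'"
    using Seq.IH(1)[of "vc c2 Q" M t q] Seq.prems c by auto
  then obtain n' t'' M'' where
    2: "run P (q + code_len c1, M') n' (q + code_len c1 + code_len c2, M'')"
      "t' + n' \<le> t''" "Q M'' t''"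
    using Seq.IH(2)[of Q M' t' "q + code_len c1"] Seq.prems run_word_ok[OF 1(1)] c by auto
  have "run P (q, M) (n + n') (q + code_len (c1 ;; c2), M'')"
    using run_trans[OF 1(1) 2(1)] by (simp add: add.assoc)
  then show ?case using 1 2 by (intro exI[of _ "n + n'"] exI[of _ t''] exI[of _ M'']) auto
next
  case (If_Le a b c1 c2)
  let ?j = "JmpLe 0 0 (q + code_len c1 + code_len c2 + 2)"
  have j1: "run P (q, M) 1 (if M a \<le> M b then q + code_len c2 + 2 else Suc q, M)"
    using run_jump If_Le.prems by auto
  have "code_at P (Suc q) (compile c2 (q + 1) @ ?j # compile c1 (q + code_len c2 + 2))"
    using code_at_Cons If_Le.prems(4) by simp
  note c = code_at_append[OF this]
  have c2: "code_at P (Suc q) (compile c2 (Suc q))"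
    and cj: "code_at P (Suc (q + code_len c2)) (?j # compile c1 (q + code_len c2 + 2))"
    using c by auto
  have c1: "code_at P (q + code_len c2 + 2) (compile c1 (q + code_len c2 + 2))"
    using code_at_Cons[OF cj] by simp
  show ?case
  proof (cases "M a \<le> M b")
    case True
    then obtain n t' M' where
      1: "run P (q + code_len c2 + 2, M) n (q + code_len c2 + 2 + code_len c1, M')"
        "t + 2 + n \<le> t'" "Q M' t'"
      using If_Le.IH(1)[OF _ _ _ c1, of Q M "t + 2"] If_Le.prems by auto
    have "run P (q, M) (1 + n) (q + code_len (If_Le a b c1 c2), M')"
      using run_trans[OF j1, of n "(q + code_len c2 + 2 + code_len c1, M')"] 1 True
      by (simp add: algebra_simps)
    then show ?thesis using 1 by (intro exI[of _ "1 + n"] exI[of _ t'] exI[of _ M']) auto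
  next
    case False
    then obtain n t' M' where
      1: "run P (Suc q, M) n (Suc q + code_len c2, M')"
        "t + 2 + n \<le> t'" "Q M' t'"
      using If_Le.IH(2)[OF _ _ _ c2, of Q M "t + 2"] If_Le.prems by auto
    have j2: "run P (Suc q + code_len c2, M') 1 (q + code_len (If_Le a b c1 c2), M')"
      using run_jump[OF cj run_word_ok[OF 1(1), simplified]] by (simp add: algebra_simps)
    have "run P (q, M) (1 + n + 1) (q + code_len (If_Le a b c1 c2), M')"
      using run_trans[OF run_trans[OF _ 1(1)] j2, of "(q, M)" 1] j1 False by simp
    then show ?thesis using 1 by (intro exI[of _ "1 + n + 1"] exI[of _ t'] exI[of _ M']) auto
  qed
next
  case (While_Le a b c)
  obtain I B where I: "I M t"
    and B: "\<And>M t. I M t \<Longrightarrow> t \<le> B"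
    and body: "\<And>M t. I M t \<Longrightarrow> M a \<le> M b \<Longrightarrow> vc c I M (t + 2)"
    and exit: "\<And>M t. I M t \<Longrightarrow> \<not> M a \<le> M b \<Longrightarrow> Q M (t + 2)"
    using While_Le.prems(1) by (auto split: if_splits)
  let ?e = "q + code_len (While_Le a b c)"
  have cj1: "code_at P q (JmpLe a b (q + 2) # JmpLe 0 0 ?e # compile c (q + 2) @ [JmpLe 0 0 q])"
    using While_Le.prems(4) by (simp add: algebra_simps)
  have cj2: "code_at P (Suc q) (JmpLe 0 0 ?e # compile c (q + 2) @ [JmpLe 0 0 q])"
    using code_at_Cons[OF cj1] by simp
  have "code_at P (q + 2) (compile c (q + 2) @ [JmpLe 0 0 q])"
    using code_at_Cons[OF cj2] by simp
  note c = code_at_append[OF this]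
  have cc: "code_at P (q + 2) (compile c (q + 2))"
    and cj3: "code_at P (q + 2 + code_len c) [JmpLe 0 0 q]"
    using c by auto
  have ab: "a < 64" "b < 64" "com_ok c" using While_Le.prems by auto
  show ?case using I While_Le.prems(2)
  proof (induction "B - t" arbitrary: M t rule: less_induct)
    case less
    have j1: "run P (q, M) 1 (if M a \<le> M b then q + 2 else Suc q, M)"
      using run_jump[OF cj1 less.prems(2)] ab by auto
    show ?case
    proof (cases "M a \<le> M b")
      case True
      obtain n t' M' where
        1: "run P (q + 2, M) n (q + 2 + code_len c, M')" "t + 2 + n \<le> t'" "I M' t'"
        using While_Le.IH[OF body[OF less.prems(1) True] less.prems(2) ab(3) cc] by auto
      have j3: "run P (q + 2 + code_len c, M') 1 (q, M')"
        using run_jump[OF cj3 run_word_ok[OF 1(1), simplified]] by simp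
      \<comment> \<open>Each iteration advances the counter by at least 2, while the invariant caps
        it by \<open>B\<close>.\<close>
      have "B - t' < B - t" using 1 B[OF 1(3)] by auto
      from less.hyps[OF this 1(3)] run_word_ok[OF 1(1)]
      obtain n' t'' M'' where
        2: "run P (q, M') n' (?e, M'')" "t' + n' \<le> t''" "Q M'' t''" by auto
      have "run P (q, M) (1 + n + 1 + n') (?e, M'')"
        using run_trans[OF run_trans[OF run_trans[OF _ 1(1)] j3] 2(1), of "(q, M)" 1] j1 True by simp
      then show ?thesis using 1 2
        by (intro exI[of _ "1 + n + 1 + n'"] exI[of _ t''] exI[of _ M'']) auto
    next
      case False
      have j2: "run P (Suc q, M) 1 (?e, M)"
        using run_jump[OF cj2 less.prems(2)] by simp
      have "run P (q, M) (1 + 1) (?e, M)"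
        using run_trans[OF _ j2, of "(q, M)" 1] j1 False by simp
      then show ?thesis using exit[OF less.prems(1) False]
        by (intro exI[of _ "1 + 1"] exI[of _ "t + 2"] exI[of _ M]) auto
    qed
  qed
qed

lemma ram_computes_vc:
  assumes "vc c (\<lambda>M t. M 0 = out \<and> t \<le> T) (snd (init_config ns)) 0"
    and "\<forall>x\<in>set ns. x < W" and "com_ok c" and "T \<le> time" and "N \<le> space" and "W \<le> word"
  shows "ram_computes (compile c 0) r w ns out time space word"
proof -
  let ?P = "compile c 0"
  have i: "init_config ns = (0, snd (init_config ns))"
    by (simp add: init_config_def)
  have "word_ok (snd (init_config ns))"
    using assms(2) W128 by (auto simp: init_config_def word_ok_def)
  moreover have "code_at ?P 0 ?P" by (auto simp: code_at_def)
  ultimately obtain n t' M' where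
    1: "run ?P (init_config ns) n (code_len c, M')" "n \<le> t'" "M' 0 = out" "t' \<le> T"
    using vc_sound[OF assms(1) _ assms(3), of ?P 0] i by auto
  note f = run_funpow[OF 1(1)]
  have "(\<Union>s<n. step_cells ?P (config_at ?P r w ns s)) \<subseteq> {..<N}"
    using f(2) by (auto simp: config_at_def)
  then have "card (\<Union>s<n. step_cells ?P (config_at ?P r w ns s)) \<le> N"
    using card_mono[of "{..<N}"] by fastforce
  moreover have "snd (config_at ?P r w ns s) a < word" if "s \<le> n" for s a
    using f(3)[OF that] assms(6) by (auto simp: config_at_def word_ok_def intro: less_le_trans)
  ultimately show ?thesis
    unfolding ram_computes_def using 1 f(1) assms(4,5)
    by (intro exI[of _ n] conjI allI impI) (auto simp: config_at_def halted_def)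
qed

end

section \<open>The recurrence for the optimum\<close>

text \<open>The increments telescope along each diagonal. What survives are values in the last row
  and the last column, \<open>m + n\<close> in number and at most \<open>m\<close> each.\<close>

lemma sum_diagonal_increments_le:
  fixes f :: "nat \<Rightarrow> nat \<Rightarrow> nat"
  assumes "\<And>i j. i < m \<Longrightarrow> j < n \<Longrightarrow> f i j \<le> f (Suc i) (Suc j)"
    and "\<And>i j. i \<le> m \<Longrightarrow> j \<le> n \<Longrightarrow> f i j \<le> m"
  shows "(\<Sum>i<m. \<Sum>j<n. f (Suc i) (Suc j) - f i j) \<le> m * (m + n)"
proof -
  have shift: "(\<Sum>i<b. g (Suc i)) \<le> (\<Sum>i<b. g i) + g b" for g :: "nat \<Rightarrow> nat" and b
    by (induction b) auto
  have "(\<Sum>i<m. \<Sum>j<n. f (Suc i) (Suc j) - f i j) + (\<Sum>i<m. \<Sum>j<n. f i j)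
      = (\<Sum>i<m. \<Sum>j<n. f (Suc i) (Suc j))"
    using assms(1) by (simp flip: sum.distrib)
  also have "\<dots> \<le> (\<Sum>i<m. (\<Sum>j<n. f (Suc i) j) + f (Suc i) n)"
    by (intro sum_mono shift)
  also have "\<dots> = (\<Sum>i<m. \<Sum>j<n. f (Suc i) j) + (\<Sum>i<m. f (Suc i) n)"
    by (simp add: sum.distrib)
  also have "(\<Sum>i<m. f (Suc i) n) \<le> (\<Sum>i<m. m)"
    using assms(2) by (intro sum_mono) auto
  also have "(\<Sum>i<m. \<Sum>j<n. f (Suc i) j) \<le> (\<Sum>i<m. \<Sum>j<n. f i j) + (\<Sum>j<n. f m j)"
    using shift[where g = "\<lambda>i. \<Sum>j<n. f i j"] .
  also have "(\<Sum>j<n. f m j) \<le> (\<Sum>j<n. m)"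
    using assms(2) by (intro sum_mono) auto
  finally show ?thesis by (simp add: algebra_simps)
qed

text \<open>The position \<open>p\<close> of a predecessor of the symbol at \<open>e\<close> among the positions from \<open>s\<close> on; \<open>p = e\<close>
  encodes that there is none. With \<open>r\<inverse>\<close> in place of \<open>r\<close> one gets successors.\<close>

definition pred_index :: "'a rel \<Rightarrow> 'a list \<Rightarrow> nat \<Rightarrow> nat \<Rightarrow> nat \<Rightarrow> bool" where
  "pred_index r X e s p \<longleftrightarrow> s \<le> p \<and> p \<le> e \<and> (X ! p, X ! e) \<in> r \<and>
     (\<forall>q. s \<le> q \<and> q < e \<and> (X ! q, X ! e) \<in> r \<longrightarrow> p < e \<and> (X ! q, X ! p) \<in> r)"

locale op_lcs =
  fixes A :: "'a set" and r :: "'a rel" and k :: nat and X Y :: "'a list"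
  assumes lin: "linear_order_on A r" and k1: "1 \<le> k"
    and XA: "X \<in> lists A" and YA: "Y \<in> lists A"
begin

abbreviation "m \<equiv> length X"
abbreviation "n \<equiv> length Y"

lemma leq_refl: "x \<in> A \<Longrightarrow> (x, x) \<in> r"
  using lin by (auto simp: order_on_defs refl_on_def)

lemma leq_trans: "(x, y) \<in> r \<Longrightarrow> (y, z) \<in> r \<Longrightarrow> (x, z) \<in> r"
  using lin by (auto simp: order_on_defs dest: transD)

lemma leq_total: "x \<in> A \<Longrightarrow> y \<in> A \<Longrightarrow> (x, y) \<in> r \<or> (y, x) \<in> r"
  using lin leq_refl by (cases "x = y") (auto simp: order_on_defs total_on_def)

lemma X_in: "i < m \<Longrightarrow> X ! i \<in> A" and Y_in: "j < n \<Longrightarrow> Y ! j \<in> A"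
  using XA YA by (auto simp: in_lists_conv_set)

lemma pred_index_self: "e < m \<Longrightarrow> pred_index r X e e e" "e < m \<Longrightarrow> pred_index (r\<inverse>) X e e e"
  using leq_refl X_in by (auto simp: pred_index_def)

text \<open>When the range grows to the left by one, only the new position \<open>s\<close> can
  change the answer. This yields the predecessors for all start positions of a fixed
  \<open>e\<close> in constant time each.\<close>

lemma pred_index_step:
  assumes "pred_index r X e (Suc s) p" "s < e" "e < m"
  shows "pred_index r X e s
    (if (X ! s, X ! e) \<in> r \<and> (p = e \<or> (X ! p, X ! s) \<in> r) then s else p)"
proof -
  have p: "Suc s \<le> p" "p \<le> e" "(X ! p, X ! e) \<in> r"
    and max: "\<And>q. Suc s \<le> q \<Longrightarrow> q < e \<Longrightarrow> (X ! q, X ! e) \<in> r \<Longrightarrow> p < e \<and> (X ! q, X ! p) \<in> r"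
    using assms(1) by (auto simp: pred_index_def)
  show ?thesis
  proof (cases "(X ! s, X ! e) \<in> r \<and> (p = e \<or> (X ! p, X ! s) \<in> r)")
    case True
    have "s < e \<and> (X ! q, X ! s) \<in> r" if q: "s \<le> q" "q < e" "(X ! q, X ! e) \<in> r" for q
    proof (cases "q = s")
      case True
      then show ?thesis using assms leq_refl[OF X_in, of s] by simp
    next
      case False
      then show ?thesis using max[of q] q assms True leq_trans[of "X ! q" "X ! p"]
        by (metis Suc_leI le_eq_less_or_eq nat_less_le)
    qed
    then show ?thesis using True assms by (simp add: pred_index_def)
  next
    case False
    have "p < e \<and> (X ! q, X ! p) \<in> r" if q: "s \<le> q" "q < e" "(X ! q, X ! e) \<in> r" for q
    proof (cases "q = s")
      case True
      then show ?thesis using False q p assms leq_total[OF X_in X_in, of p s] by auto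
    next
      case False
      then show ?thesis using max[of q] q by simp
    qed
    then show ?thesis using False p by (auto simp: pred_index_def)
  qed
qed

lemma succ_index_step:
  assumes "pred_index (r\<inverse>) X e (Suc s) p" "s < e" "e < m"
  shows "pred_index (r\<inverse>) X e s
    (if (X ! e, X ! s) \<in> r \<and> (p = e \<or> (X ! s, X ! p) \<in> r) then s else p)"
proof -
  interpret c: op_lcs A "r\<inverse>" k X Y
    by unfold_locales (use lin k1 XA YA in auto)
  show ?thesis using c.pred_index_step[OF assms] by simp
qed

text \<open>\<open>iso i j l\<close>: the substrings of length \<open>l\<close> that end with the prefixes of length \<open>i\<close> and
  \<open>j\<close> of \<open>X\<close> and \<open>Y\<close> are order-isomorphic.\<close>

definition iso :: "nat \<Rightarrow> nat \<Rightarrow> nat \<Rightarrow> bool" where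
  "iso i j l \<longleftrightarrow> l \<le> i \<and> l \<le> j \<and> i \<le> m \<and> j \<le> n \<and>
     (\<forall>a<l. \<forall>b<l. (X ! (i - l + a), X ! (i - l + b)) \<in> r \<longleftrightarrow> (Y ! (j - l + a), Y ! (j - l + b)) \<in> r)"

lemma iso_0: "i \<le> m \<Longrightarrow> j \<le> n \<Longrightarrow> iso i j 0"
  by (simp add: iso_def)

lemma iso_1: "Suc i \<le> m \<Longrightarrow> Suc j \<le> n \<Longrightarrow> iso (Suc i) (Suc j) 1"
  using leq_refl[OF X_in, of i] leq_refl[OF Y_in, of j] by (simp add: iso_def)

lemma iso_le:
  assumes "iso i j l" "l' \<le> l"
  shows "iso i j l'"
proof -
  have eq: "i - l' + a = i - l + (l - l' + a)" "j - l' + a = j - l + (l - l' + a)" for a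
    using assms by (auto simp: iso_def)
  have "l - l' + a < l" if "a < l'" for a using that assms by simp
  then have "(X ! (i - l' + a), X ! (i - l' + b)) \<in> r \<longleftrightarrow> (Y ! (j - l' + a), Y ! (j - l' + b)) \<in> r"
    if "a < l'" "b < l'" for a b
    using assms(1) that unfolding iso_def eq by blast
  then show ?thesis using assms by (auto simp: iso_def)
qed

text \<open>Dropping the last symbols keeps the starts of both pieces. This limits the growth of
  \<open>iso_len\<close> along a diagonal to one per step.\<close>

lemma iso_SucD: "iso (Suc i) (Suc j) (Suc l) \<Longrightarrow> iso i j l"
  unfolding iso_def by (simp del: Nat.add_diff_assoc2 Nat.diff_add_assoc2)

text \<open>By transitivity, the comparisons of the new symbol with its two neighbours determine
  those with all earlier symbols. Both directions are compared since symbols may be equal: a tie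
  with a neighbour must occur in both strings. If a neighbour is missing (\<open>p = l\<close> or
  \<open>q = l\<close>), its conditions hold by reflexivity.\<close>

lemma order_extension_iff:
  fixes x y :: "nat \<Rightarrow> 'a"
  assumes x: "\<And>a. a \<le> l \<Longrightarrow> x a \<in> A" and y: "\<And>a. a \<le> l \<Longrightarrow> y a \<in> A"
    and iso: "\<And>a b. a < l \<Longrightarrow> b < l \<Longrightarrow> (x a, x b) \<in> r \<longleftrightarrow> (y a, y b) \<in> r"
    and p: "p \<le> l" "(x p, x l) \<in> r" "\<And>a. a < l \<Longrightarrow> (x a, x l) \<in> r \<Longrightarrow> p < l \<and> (x a, x p) \<in> r"
    and q: "q \<le> l" "(x l, x q) \<in> r" "\<And>a. a < l \<Longrightarrow> (x l, x a) \<in> r \<Longrightarrow> q < l \<and> (x q, x a) \<in> r"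
  shows "(\<forall>a<Suc l. \<forall>b<Suc l. (x a, x b) \<in> r \<longleftrightarrow> (y a, y b) \<in> r) \<longleftrightarrow>
    (y p, y l) \<in> r \<and> ((x l, x p) \<in> r \<longleftrightarrow> (y l, y p) \<in> r) \<and>
    (y l, y q) \<in> r \<and> ((x q, x l) \<in> r \<longleftrightarrow> (y q, y l) \<in> r)" (is "?L \<longleftrightarrow> ?R")
proof
  assume ?L
  then show ?R using p(1,2) q(1,2) by simp
next
  assume R: ?R
  have 1: "(x a, x l) \<in> r \<longleftrightarrow> (y a, y l) \<in> r" if a: "a < l" for a
  proof
    assume "(x a, x l) \<in> r"
    then show "(y a, y l) \<in> r" using p(3)[OF a] iso[OF a, of p] R leq_trans by blast
  next
    assume ya: "(y a, y l) \<in> r"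
    show "(x a, x l) \<in> r"
    proof (rule ccontr)
      \<comment> \<open>Then the successor \<open>q\<close> lies weakly between \<open>l\<close> and
        \<open>a\<close> in \<open>x\<close>. In \<open>y\<close> the chain \<open>y q\<close>,
        \<open>y a\<close>, \<open>y l\<close>, \<open>y q\<close> is a cycle, so all are tied;
        transferred back, \<open>x a\<close> is at most \<open>x q\<close> and \<open>x q\<close> at
        most \<open>x l\<close>.\<close>
      assume n: "(x a, x l) \<notin> r"
      then have "(x l, x a) \<in> r" using leq_total x a by (meson less_imp_le order_refl)
      then have qa: "q < l" "(x q, x a) \<in> r" using q(3)[OF a] by auto
      then have "(y q, y a) \<in> r" using iso a by blast
      then have "(y q, y l) \<in> r" using ya leq_trans by blast
      then have "(x q, x l) \<in> r" using R by blast
      moreover have "(y a, y q) \<in> r" using ya R leq_trans by blast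
      then have "(x a, x q) \<in> r" using iso a qa by blast
      ultimately show False using n leq_trans by blast
    qed
  qed
  have 2: "(x l, x a) \<in> r \<longleftrightarrow> (y l, y a) \<in> r" if a: "a < l" for a
  proof
    assume "(x l, x a) \<in> r"
    then show "(y l, y a) \<in> r" using q(3)[OF a] iso[OF _ a, of q] R leq_trans by blast
  next
    assume ya: "(y l, y a) \<in> r"
    show "(x l, x a) \<in> r"
    proof (rule ccontr)
      assume n: "(x l, x a) \<notin> r"
      then have "(x a, x l) \<in> r" using leq_total x a by (meson less_imp_le order_refl)
      then have pa: "p < l" "(x a, x p) \<in> r" using p(3)[OF a] by auto
      then have "(y a, y p) \<in> r" using iso a by blast
      then have "(y l, y p) \<in> r" using ya leq_trans by blast
      then have "(x l, x p) \<in> r" using R by blast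
      moreover have "(y p, y a) \<in> r" using ya R leq_trans by blast
      then have "(x p, x a) \<in> r" using iso a pa by blast
      ultimately show False using n leq_trans by blast
    qed
  qed
  have "(x l, x l) \<in> r" "(y l, y l) \<in> r" using x y leq_refl by auto
  then show ?L using 1 2 iso by (auto simp: less_Suc_eq)
qed

text \<open>Positions correspond by their distance from the ends, so position \<open>p\<close> of
  \<open>X\<close> matches position \<open>j + p - i\<close> of \<open>Y\<close>.\<close>

lemma iso_Suc_iff:
  assumes iso: "iso i j l" and ij: "i < m" "j < n"
    and p: "pred_index r X i (i - l) p" and q: "pred_index (r\<inverse>) X i (i - l) q"
  shows "iso (Suc i) (Suc j) (Suc l) \<longleftrightarrow>
    (Y ! (j + p - i), Y ! j) \<in> r \<and> ((X ! i, X ! p) \<in> r \<longleftrightarrow> (Y ! j, Y ! (j + p - i)) \<in> r) \<and>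
    (Y ! j, Y ! (j + q - i)) \<in> r \<and> ((X ! q, X ! i) \<in> r \<longleftrightarrow> (Y ! (j + q - i), Y ! j) \<in> r)"
proof -
  have l: "l \<le> i" "l \<le> j" using iso by (auto simp: iso_def)
  define s u where "s = i - l" and "u = j - l"
  have i: "i = s + l" and j: "j = u + l" using l by (auto simp: s_def u_def)
  obtain p' q' where pq: "p = s + p'" "q = s + q'"
    using p q unfolding pred_index_def s_def[symmetric] by (meson le_Suc_ex)
  have 1: "p' \<le> l" "(X ! (s + p'), X ! (s + l)) \<in> r"
    "\<And>a. a < l \<Longrightarrow> (X ! (s + a), X ! (s + l)) \<in> r \<Longrightarrow> p' < l \<and> (X ! (s + a), X ! (s + p')) \<in> r"
    using p[unfolded pred_index_def i pq] by (simp, simp, metis add_diff_cancel_right' le_add1 nat_add_left_cancel_less)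
  have 2: "q' \<le> l" "(X ! (s + l), X ! (s + q')) \<in> r"
    "\<And>a. a < l \<Longrightarrow> (X ! (s + l), X ! (s + a)) \<in> r \<Longrightarrow> q' < l \<and> (X ! (s + q'), X ! (s + a)) \<in> r"
    using q[unfolded pred_index_def i pq] by (simp, simp, metis add_diff_cancel_right' converse_iff le_add1 nat_add_left_cancel_less)
  have 3: "\<And>a b. a < l \<Longrightarrow> b < l \<Longrightarrow>
      (X ! (s + a), X ! (s + b)) \<in> r \<longleftrightarrow> (Y ! (u + a), Y ! (u + b)) \<in> r"
    using iso by (auto simp: iso_def s_def u_def)
  have "X ! (s + a) \<in> A" "Y ! (u + a) \<in> A" if "a \<le> l" for a
    using X_in Y_in ij i j that by auto
  note order_extension_iff[of l "\<lambda>a. X ! (s + a)" "\<lambda>a. Y ! (u + a)", OF this 3 1 2]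
  then show ?thesis using ij i j by (simp add: iso_def pq)
qed

definition iso_len :: "nat \<Rightarrow> nat \<Rightarrow> nat" where
  "iso_len i j = (GREATEST l. iso i j l)"

lemma iso_iff_le_iso_len: "i \<le> m \<Longrightarrow> j \<le> n \<Longrightarrow> iso i j l \<longleftrightarrow> l \<le> iso_len i j"
proof -
  assume ij: "i \<le> m" "j \<le> n"
  have b: "\<forall>y. iso i j y \<longrightarrow> y \<le> i" by (simp add: iso_def)
  have "iso i j (iso_len i j)"
    unfolding iso_len_def using GreatestI_nat[of "iso i j" 0 i] iso_0 ij b by blast
  moreover have "iso i j l \<Longrightarrow> l \<le> iso_len i j"
    unfolding iso_len_def using Greatest_le_nat[of "iso i j" l i] b by blast
  ultimately show ?thesis using iso_le by blast
qed

lemma iso_len_le: "i \<le> m \<Longrightarrow> j \<le> n \<Longrightarrow> iso_len i j \<le> i \<and> iso_len i j \<le> j"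
  using iso_iff_le_iso_len[of i j "iso_len i j"] by (auto simp: iso_def)

lemma iso_len_Suc_le: "Suc i \<le> m \<Longrightarrow> Suc j \<le> n \<Longrightarrow> iso_len (Suc i) (Suc j) \<le> Suc (iso_len i j)"
  using iso_iff_le_iso_len[of "Suc i" "Suc j" "iso_len (Suc i) (Suc j)"] iso_iff_le_iso_len[of i j] iso_SucD
  by (cases "iso_len (Suc i) (Suc j)") auto

text \<open>Single symbols are always isomorphic, so the downward scan for \<open>iso_len\<close>
  stops at a positive length.\<close>

lemma iso_len_Suc_ge: "Suc i \<le> m \<Longrightarrow> Suc j \<le> n \<Longrightarrow> 1 \<le> iso_len (Suc i) (Suc j)"
  using iso_1 iso_iff_le_iso_len by blast

section \<open>Achievable lengths and their witnesses\<close>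

inductive achievable :: "nat \<Rightarrow> nat \<Rightarrow> nat \<Rightarrow> bool" where
  achievable_0: "achievable i j 0"
| achievable_mono: "achievable i j v \<Longrightarrow> i \<le> i' \<Longrightarrow> j \<le> j' \<Longrightarrow> achievable i' j' v"
| achievable_add: "achievable i j v \<Longrightarrow> k \<le> l \<Longrightarrow> iso (i + l) (j + l) l \<Longrightarrow>
    achievable (i + l) (j + l) (v + l)"

lemma achievable_le: "achievable i j v \<Longrightarrow> v \<le> i \<and> v \<le> j"
  by (induction rule: achievable.induct) auto

text \<open>Normal form of the last derivation step: either one prefix can be shortened by one
  symbol, or a last piece ends exactly at both prefix ends. This is the hard direction of the
  recurrence.\<close>

lemma achievable_cases:
  "achievable i j v \<Longrightarrow> v = 0 \<or> 1 \<le> i \<and> 1 \<le> j \<and>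
     (achievable (i - 1) j v \<or> achievable i (j - 1) v \<or>
      (\<exists>l\<ge>k. iso i j l \<and> l \<le> v \<and> achievable (i - l) (j - l) (v - l)))"
proof (induction rule: achievable.induct)
  case (achievable_mono i j v i' j')
  consider "i = i' \<and> j = j'" | "i < i'" | "j < j'"
    using achievable_mono by linarith
  then show ?case
  proof cases
    case 1 then show ?thesis using achievable_mono by auto
  next
    case 2
    then have "achievable (i' - 1) j' v" using achievable_mono achievable.achievable_mono[of i j v] by auto
    then show ?thesis using achievable_le[of "i' - 1" j' v] 2 by auto
  next
    case 3
    then have "achievable i' (j' - 1) v" using achievable_mono achievable.achievable_mono[of i j v] by auto
    then show ?thesis using achievable_le[of i' "j' - 1" v] 3 by auto
  qed
next
  case (achievable_add i j v l)
  then show ?case using k1 by (auto intro!: exI[of _ l])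
qed auto

lemma iso_iff_order_iso:
  assumes "has_substr X i l" "has_substr Y j l"
  shows "iso (i - 1 + l) (j - 1 + l) l \<longleftrightarrow> order_iso r (substr X i l) (substr Y j l)"
  using assms by (auto simp: iso_def order_iso_def substr_def has_substr_def)

text \<open>The bounds \<open>i\<close> and \<open>j\<close> on the ends of the pieces allow an
  induction over prefixes while \<open>X\<close> and \<open>Y\<close> stay fixed.\<close>

definition pieces ::
    "nat \<Rightarrow> nat \<Rightarrow> 'a list \<Rightarrow> nat \<Rightarrow> (nat \<Rightarrow> nat) \<Rightarrow> (nat \<Rightarrow> nat) \<Rightarrow> (nat \<Rightarrow> nat) \<Rightarrow> (nat \<Rightarrow> nat) \<Rightarrow> bool" where
  "pieces i j Z t f g p l \<longleftrightarrow>
     (\<forall>s. 1 \<le> s \<and> s \<le> t \<longrightarrow> k \<le> l s \<and>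
       has_substr X (f s) (l s) \<and> has_substr Y (g s) (l s) \<and> has_substr Z (p s) (l s) \<and>
       order_iso r (substr X (f s) (l s)) (substr Y (g s) (l s)) \<and>
       order_iso r (substr Y (g s) (l s)) (substr Z (p s) (l s)) \<and>
       f s + l s \<le> i + 1 \<and> g s + l s \<le> j + 1) \<and>
     (\<forall>s. 1 \<le> s \<and> s < t \<longrightarrow>
       f s + l s \<le> f (s + 1) \<and> g s + l s \<le> g (s + 1) \<and> p (s + 1) = p s + l s) \<and>
     (if t = 0 then Z = [] else p 1 = 1 \<and> length Z = p t + l t - 1)"

lemma op_common_subseq_iff: "op_common_subseq r k X Y Z \<longleftrightarrow> (\<exists>t f g p l. pieces m n Z t f g p l)"
  unfolding op_common_subseq_def pieces_def
  by (intro ex_cong1) (auto simp: has_substr_def)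

lemma achievable_of_pieces:
  assumes "pieces m n Z t f g p l"
  shows "achievable m n (length Z)"
proof -
  note pieces = assms[unfolded pieces_def]
  have pos: "1 \<le> f s" "1 \<le> g s" "1 \<le> p s" "f s + l s \<le> m + 1" "g s + l s \<le> n + 1"
    and iso: "k \<le> l s" "iso (f s - 1 + l s) (g s - 1 + l s) (l s)" if "1 \<le> s" "s \<le> t" for s
    using pieces that iso_iff_order_iso by (simp_all add: has_substr_def)
  have succ: "f s + l s \<le> f (Suc s)" "g s + l s \<le> g (Suc s)" "p (Suc s) = p s + l s"
    if "1 \<le> s" "s < t" for s
    using pieces that by simp_all
  have "achievable (f s - 1 + l s) (g s - 1 + l s) (p s - 1 + l s)" if "1 \<le> s" "s \<le> t" for s
    using that
  proof (induction s rule: dec_induct)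
    case base
    then show ?case using achievable_add[OF achievable_0 iso, of 1] pieces by auto
  next
    case (step s)
    have "achievable (f (Suc s) - 1) (g (Suc s) - 1) (p s - 1 + l s)"
      by (rule achievable_mono[OF step.IH]) (use succ[of s] pos[of s] step.prems step.hyps in auto)
    then have "achievable (f (Suc s) - 1 + l (Suc s)) (g (Suc s) - 1 + l (Suc s))
        (p s - 1 + l s + l (Suc s))"
      by (rule achievable_add) (use iso[of "Suc s"] step.prems in auto)
    moreover have "p s - 1 + l s = p (Suc s) - 1"
      using succ(3)[of s] pos(3)[of s] step by simp
    ultimately show ?case by simp
  qed
  then have *: "achievable (f t - 1 + l t) (g t - 1 + l t) (p t - 1 + l t)" if "t \<noteq> 0"
    using that by simp
  show ?thesis
  proof (cases "t = 0")
    case True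
    then show ?thesis using pieces achievable_0 by simp
  next
    case False
    then have "length Z = p t - 1 + l t" using pieces pos(3)[of t] by simp
    then show ?thesis using achievable_mono[OF *[OF False], of m n] pos[of t] False by simp
  qed
qed

lemma substr_append: "has_substr Z p l \<Longrightarrow> substr (Z @ Z') p l = substr Z p l"
  by (auto simp: substr_def has_substr_def)

text \<open>The witness \<open>Z\<close> is built by copying the pieces of \<open>Y\<close>; no
  compatibility between different pieces is demanded, so any concatenation qualifies.\<close>

lemma pieces_append:
  assumes pieces: "pieces i j Z t f g p l" and l0: "k \<le> l0" "iso (i + l0) (j + l0) l0"
  shows "pieces (i + l0) (j + l0) (Z @ substr Y (j + 1) l0) (t + 1)
    (f(t + 1 := i + 1)) (g(t + 1 := j + 1)) (p(t + 1 := length Z + 1)) (l(t + 1 := l0))"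
proof -
  let ?f = "f(t + 1 := i + 1)" and ?g = "g(t + 1 := j + 1)" and ?p = "p(t + 1 := length Z + 1)"
    and ?l = "l(t + 1 := l0)"
  note pieces = pieces[unfolded pieces_def]
  define S where "S = substr Y (j + 1) l0"
  have b: "i + l0 \<le> m" "j + l0 \<le> n" using l0 by (auto simp: iso_def)
  then have S: "length S = l0" by (auto simp: S_def substr_def)
  have oiso: "order_iso r (substr X (i + 1) l0) S"
    using iso_iff_order_iso[of "i + 1" l0 "j + 1"] l0 b
    by (simp add: has_substr_def S_def)
  have new: "substr (Z @ S) (length Z + 1) l0 = S" "order_iso r S S"
    using S by (auto simp: substr_def order_iso_def)
  have 1: "k \<le> ?l s \<and>
         has_substr X (?f s) (?l s) \<and> has_substr Y (?g s) (?l s) \<and> has_substr (Z @ S) (?p s) (?l s) \<and>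
         order_iso r (substr X (?f s) (?l s)) (substr Y (?g s) (?l s)) \<and>
         order_iso r (substr Y (?g s) (?l s)) (substr (Z @ S) (?p s) (?l s)) \<and>
         ?f s + ?l s \<le> i + l0 + 1 \<and> ?g s + ?l s \<le> j + l0 + 1" if "1 \<le> s" "s \<le> t + 1" for s
  proof (cases "s = t + 1")
    case True
    then show ?thesis
      using new oiso b S l0 S_def[symmetric] by (simp add: has_substr_def)
  next
    case False
    then have s: "s \<le> t" using that by simp
    have "has_substr Z (p s) (l s)" using pieces that s by blast
    then have "has_substr (Z @ S) (p s) (l s)" "substr (Z @ S) (p s) (l s) = substr Z (p s) (l s)"
      using substr_append by (auto simp: has_substr_def)
    moreover have "?f s = f s" "?g s = g s" "?p s = p s" "?l s = l s" using False by auto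
    moreover have "f s + l s \<le> i + l0 + 1" "g s + l s \<le> j + l0 + 1"
      using pieces that s by (meson le_add1 le_trans add_le_mono1)+
    ultimately show ?thesis using pieces that s by metis
  qed
  have 2: "?f s + ?l s \<le> ?f (s + 1) \<and> ?g s + ?l s \<le> ?g (s + 1) \<and> ?p (s + 1) = ?p s + ?l s"
    if s: "1 \<le> s" "s < t + 1" for s
  proof (cases "s = t")
    case True
    have "1 \<le> p t" using pieces s True by (simp add: has_substr_def)
    then show ?thesis using s pieces True by simp
  next
    case False
    then show ?thesis using s pieces by simp
  qed
  have 3: "?p 1 = 1 \<and> length (Z @ S) = ?p (t + 1) + ?l (t + 1) - 1"
    using pieces S by (auto split: if_splits)
  show ?thesis
    unfolding pieces_def S_def[symmetric] using 1 2 3 by (simp del: fun_upd_apply)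
qed

lemma pieces_of_achievable:
  assumes "achievable i j v" "i \<le> m" "j \<le> n"
  shows "\<exists>Z t f g p l. Z \<in> lists A \<and> length Z = v \<and> pieces i j Z t f g p l"
  using assms
proof (induction rule: achievable.induct)
  case (achievable_0 i j)
  have "pieces i j [] 0 id id id id" by (simp add: pieces_def)
  then show ?case by force
next
  case (achievable_mono i j v i' j')
  then obtain Z t f g p l where Z: "Z \<in> lists A" "length Z = v" and "pieces i j Z t f g p l"
    by (meson le_trans)
  then have "pieces i' j' Z t f g p l"
    using achievable_mono.hyps(2,3) unfolding pieces_def by (meson add_le_mono1 le_trans)
  then show ?case using Z by blast
next
  case (achievable_add i j v l0)
  then obtain Z t f g p l where Z: "Z \<in> lists A" "length Z = v" and "pieces i j Z t f g p l"
    using add_leD1 by blast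
  from pieces_append[OF this(3) achievable_add.hyps(2,3)]
  show ?case using Z achievable_add.prems YA
    by (intro exI[of _ "Z @ substr Y (j + 1) l0"])
      (force simp: substr_def in_lists_conv_set dest!: in_set_takeD in_set_dropD)
qed

section \<open>The optimum and window maxima along a diagonal\<close>

definition opt :: "nat \<Rightarrow> nat \<Rightarrow> nat" where
  "opt i j = (GREATEST v. achievable i j v)"

lemma achievable_opt: "achievable i j (opt i j)"
  unfolding opt_def using GreatestI_nat[of "achievable i j" 0 i] achievable_0 achievable_le by blast

lemma opt_ge: "achievable i j v \<Longrightarrow> v \<le> opt i j"
  unfolding opt_def using Greatest_le_nat[of "achievable i j" v i] achievable_le by blast

lemma opt_le: "opt i j \<le> i"
  using achievable_le achievable_opt by blast

lemma opt_0 [simp]: "opt 0 j = 0" "opt i 0 = 0"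
  using achievable_le[OF achievable_opt, of 0 j] achievable_le[OF achievable_opt, of i 0] by auto

lemma is_op_LCS_opt: "\<exists>Z. is_op_LCS A r k X Y Z \<and> length Z = opt m n"
  using pieces_of_achievable[OF achievable_opt[of m n]] opt_ge achievable_of_pieces
  unfolding is_op_LCS_def op_common_subseq_iff by (metis order_refl)

text \<open>A piece that starts in cell \<open>(s, u)\<close> and ends in row \<open>i\<close> yields
  \<open>opt s u + (i - s) = start_val s u + i - m\<close>, so along a diagonal one maximises \<open>start_val\<close>,
  independently of \<open>i\<close>.\<close>

definition start_val :: "nat \<Rightarrow> nat \<Rightarrow> nat" where
  "start_val s u = opt s u + (m - s)"

text \<open>The window is indexed by piece lengths \<open>y\<close>, with start cells
  \<open>(i - y, j - y)\<close>; the inserted 0 is the value of an empty window.\<close>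

definition diag_max :: "nat \<Rightarrow> nat \<Rightarrow> nat \<Rightarrow> nat \<Rightarrow> nat" where
  "diag_max i j a b = Max (insert 0 ((\<lambda>y. start_val (i - y) (j - y)) ` {a..b}))"

text \<open>Seen from the next cell of the diagonal, the same start cells belong to lengths larger
  by one. Stored maxima thus stay valid when the cell advances.\<close>

lemma diag_max_Suc_Suc: "diag_max (Suc i) (Suc j) (Suc a) (Suc b) = diag_max i j a b"
proof -
  have "(\<lambda>y. start_val (Suc i - y) (Suc j - y)) ` {Suc a..Suc b} = (\<lambda>y. start_val (i - y) (j - y)) ` {a..b}"
    by (simp only: image_Suc_atLeastAtMost[symmetric] image_image diff_Suc_Suc)
  then show ?thesis by (simp only: diag_max_def)
qed

lemma diag_max_empty: "b < a \<Longrightarrow> diag_max i j a b = 0"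
  by (simp add: diag_max_def)

lemma diag_max_snoc: "a \<le> Suc b \<Longrightarrow> diag_max i j a (Suc b) = max (diag_max i j a b) (start_val (i - Suc b) (j - Suc b))"
proof -
  assume "a \<le> Suc b"
  then have "insert 0 ((\<lambda>y. start_val (i - y) (j - y)) ` {a..Suc b})
      = insert (start_val (i - Suc b) (j - Suc b)) (insert 0 ((\<lambda>y. start_val (i - y) (j - y)) ` {a..b}))"
    by (auto simp: atLeastAtMostSuc_conv)
  then show ?thesis
    by (simp add: diag_max_def max.commute del: image_Suc_atLeastAtMost)
qed

lemma diag_max_append:
  assumes "a \<le> Suc b" "b \<le> c"
  shows "diag_max i j a c = max (diag_max i j a b) (diag_max i j (Suc b) c)"
  using assms(2,1)
proof (induction c rule: dec_induct)
  case base
  then show ?case by (simp add: diag_max_empty)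
next
  case (step c)
  then show ?case by (simp add: diag_max_snoc max.assoc)
qed

lemma diag_max_Cons: "a \<le> b \<Longrightarrow> diag_max i j a b = max (start_val (i - a) (j - a)) (diag_max i j (Suc a) b)"
  using diag_max_append[of a a b i j] by (simp add: diag_max_def)

lemma opt_rec:
  assumes ij: "1 \<le> i" "i \<le> m" "1 \<le> j" "j \<le> n"
  shows "opt i j = max (max (opt (i - 1) j) (opt i (j - 1)))
    (if k \<le> iso_len i j then diag_max i j k (iso_len i j) + i - m else 0)" (is "_ = ?R")
proof (rule antisym)
  show "?R \<le> opt i j"
  proof -
    have "opt (i - 1) j \<le> opt i j" "opt i (j - 1) \<le> opt i j"
      by (intro opt_ge achievable_mono[OF achievable_opt]; simp)+
    moreover have "diag_max i j k (iso_len i j) + i - m \<le> opt i j"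
    proof -
      have "diag_max i j k (iso_len i j) \<in> insert 0 ((\<lambda>y. start_val (i - y) (j - y)) ` {k..iso_len i j})"
        unfolding diag_max_def by (rule Max_in) auto
      then consider "diag_max i j k (iso_len i j) = 0"
        | y where "k \<le> y" "y \<le> iso_len i j" "diag_max i j k (iso_len i j) = start_val (i - y) (j - y)" by auto
      then show ?thesis
      proof cases
        \<comment> \<open>The default 0 contributes \<open>i - m\<close>, which truncates to
          0.\<close>
        case 1 then show ?thesis using ij by simp
      next
        case (2 y)
        have iso: "iso i j y" using 2 iso_iff_le_iso_len ij by auto
        then have y: "y \<le> i" "y \<le> j" by (auto simp: iso_def)
        have "achievable (i - y + y) (j - y + y) (opt (i - y) (j - y) + y)"
          by (rule achievable_add[OF achievable_opt 2(1)]) (use iso y in simp)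
        then have "opt (i - y) (j - y) + y \<le> opt i j" using opt_ge[of i j] y by simp
        then show ?thesis using 2 y ij by (simp add: start_val_def)
      qed
    qed
    ultimately show ?thesis by simp
  qed
  show "opt i j \<le> ?R"
    using achievable_cases[OF achievable_opt[of i j]]
  proof (elim disjE conjE exE)
    fix l assume l: "k \<le> l" "iso i j l" "l \<le> opt i j" "achievable (i - l) (j - l) (opt i j - l)"
    have y: "l \<le> i" "l \<le> j" "l \<le> iso_len i j" using l ij iso_iff_le_iso_len by (auto simp: iso_def)
    have "start_val (i - l) (j - l) \<le> diag_max i j k (iso_len i j)"
      unfolding diag_max_def using y l by (intro Max_ge) auto
    then have "opt i j \<le> diag_max i j k (iso_len i j) + i - m"
      using opt_ge[OF l(4)] y ij by (simp add: start_val_def)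
    then show ?thesis using y l by auto
  qed (use opt_ge[of "i - 1" j "opt i j"] opt_ge[of i "j - 1" "opt i j"] in auto)
qed

text \<open>Rows of the diagonal below \<open>split_row i j\<close> belong to the stack of the queue that stores suffix maxima.
  That stack is rebuilt as soon as the window has left it.\<close>

fun split_row :: "nat \<Rightarrow> nat \<Rightarrow> nat" where
  "split_row 0 j = 0"
| "split_row (Suc i) 0 = 0"
| "split_row (Suc i) (Suc j) =
    (if k \<le> iso_len (Suc i) (Suc j) \<and> Suc i - iso_len (Suc i) (Suc j) < split_row i j then split_row i j
     else Suc (Suc i) - k)"

text \<open>The last start row of a window is \<open>i - k\<close>. The bound is one past it and is
  attained after a rebuild, when the second stack is empty.\<close>

lemma split_row_le: "split_row i j \<le> Suc i - k"
  by (induction i j rule: split_row.induct) auto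

lemma split_row_Suc_mono: "split_row i j \<le> split_row (Suc i) (Suc j)"
  using split_row_le[of i j] by (simp del: diff_Suc_Suc, linarith)

lemma split_row_add_mono: "split_row i j \<le> split_row (i + d) (j + d)"
proof (induction d)
  case (Suc d)
  then show ?case using split_row_Suc_mono[of "i + d" "j + d"] by simp
qed simp

text \<open>Invariant of the two-stack queue of a diagonal: \<open>suf\<close> holds the suffix maxima of the rows
  below \<open>split_row i j\<close>, and \<open>pre\<close> the maximum over the remaining rows of the window.\<close>

definition queue :: "nat \<Rightarrow> nat \<Rightarrow> nat \<Rightarrow> (nat \<Rightarrow> nat \<Rightarrow> nat) \<Rightarrow> bool" where
  "queue i j pre suf \<longleftrightarrow> (k \<le> iso_len i j \<longrightarrow> pre = diag_max i j k (i - split_row i j) \<and>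
     (\<forall>x. i - split_row i j < x \<and> x \<le> iso_len i j \<longrightarrow> suf (i - x) (j - x) = diag_max i j (Suc (i - split_row i j)) x))"

text \<open>The start row \<open>Suc i - k\<close> enters the second stack, whose maximum absorbs
  it; rows that leave are simply skipped in the suffix maxima. The window maximum combines one
  suffix maximum with the maximum of the second stack.\<close>

lemma queue_keep:
  assumes q: "queue i j pre suf" and ij: "Suc i \<le> m" "Suc j \<le> n"
    and L: "L = iso_len (Suc i) (Suc j)" "k \<le> L" "Suc i - L < split_row i j"
  shows "k \<le> iso_len i j"
    and "queue (Suc i) (Suc j) (max pre (start_val (Suc i - k) (Suc j - k))) suf"
    and "diag_max (Suc i) (Suc j) k L = max (suf (Suc i - L) (Suc j - L)) (max pre (start_val (Suc i - k) (Suc j - k)))"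
proof -
  have Ll: "L \<le> Suc i" "L \<le> Suc j" "L \<le> Suc (iso_len i j)"
    using iso_len_le[of "Suc i" "Suc j"] iso_len_Suc_le[of i j] ij L by auto
  show k: "k \<le> iso_len i j" using split_row_le[of i j] L Ll by linarith
  \<comment> \<open>In terms of lengths, the second stack holds the start rows of lengths up to
    \<open>e\<close>; at the next cell this becomes \<open>Suc e\<close>.\<close>
  define e where "e = i - split_row i j"
  have e: "Suc i - split_row i j = Suc e" "k \<le> Suc e" "e < L" "split_row i j \<le> i"
    using split_row_le[of i j] L Ll k1 by (auto simp: e_def)
  have E: "split_row (Suc i) (Suc j) = split_row i j" using L by simp
  have pre: "pre = diag_max i j k e"
    and suf: "\<And>x. e < x \<Longrightarrow> x \<le> iso_len i j \<Longrightarrow> suf (i - x) (j - x) = diag_max i j (Suc e) x"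
    using q k unfolding queue_def e_def by auto
  have pre': "diag_max (Suc i) (Suc j) k (Suc e) = max pre (start_val (Suc i - k) (Suc j - k))"
    using diag_max_Cons[of k "Suc e" "Suc i" "Suc j"] e pre by (simp add: diag_max_Suc_Suc max.commute)
  have suf': "suf (Suc i - x) (Suc j - x) = diag_max (Suc i) (Suc j) (Suc (Suc e)) x"
    if "Suc e < x" "x \<le> L" for x
    using that suf[of "x - 1"] Ll diag_max_Suc_Suc[of i j "Suc e" "x - 1"] by (cases x) auto
  show "queue (Suc i) (Suc j) (max pre (start_val (Suc i - k) (Suc j - k))) suf"
    unfolding queue_def E e(1) L(1)[symmetric] using pre' suf' by auto
  have "Suc e < L" using L e Ll by linarith
  then show "diag_max (Suc i) (Suc j) k L = max (suf (Suc i - L) (Suc j - L)) (max pre (start_val (Suc i - k) (Suc j - k)))"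
    using diag_max_append[of k "Suc e" L "Suc i" "Suc j"] pre' suf'[of L] e by (simp add: max.commute)
qed

lemma queue_rebuild:
  assumes "split_row (Suc i) (Suc j) = Suc (Suc i) - k" "iso_len (Suc i) (Suc j) \<le> Suc i"
    and "\<And>x. k \<le> x \<Longrightarrow> x \<le> iso_len (Suc i) (Suc j) \<Longrightarrow> suf (Suc i - x) (Suc j - x) = diag_max (Suc i) (Suc j) k x"
  shows "queue (Suc i) (Suc j) 0 suf"
proof -
  have "Suc i - split_row (Suc i) (Suc j) = k - 1" if "k \<le> iso_len (Suc i) (Suc j)"
    unfolding assms(1) using k1 assms(2) that by auto
  then show ?thesis
    using assms(3) k1 by (auto simp: queue_def diag_max_empty)
qed

lemma queue_cong:
  assumes "queue i j pre suf"
    and "\<And>x. k \<le> iso_len i j \<Longrightarrow> i - split_row i j < x \<Longrightarrow> x \<le> iso_len i j \<Longrightarrow> suf' (i - x) (j - x) = suf (i - x) (j - x)"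
  shows "queue i j pre suf'"
  using assms unfolding queue_def by auto

end

section \<open>The program\<close>

text \<open>
  Registers: 0--2 hold \<open>m\<close>, \<open>n\<close>, \<open>k\<close>; 3--5 hold the constants 0, 1, \<open>n + 1\<close>; 6 and 7 are scratch;
  8--11 hold \<open>i\<close>, \<open>j\<close>, \<open>i - 1\<close>, \<open>j - 1\<close> for the current cell; 12 and 13 hold the candidate for
  \<open>iso_len i j\<close> and whether it was rejected; 14 is a start row; 15 and 16 hold the predecessor and the
  successor; 30 is the best value so far; 32 and 39 hold \<open>split_row\<close> and the maximum of the second stack;
  34 and 35 are the piece length and the running maximum of a rebuild.

  Two-dimensional arrays are interleaved row by row from address 64 on: 0 holds \<open>opt\<close>, 1 \<open>iso_len\<close>,
  2 \<open>split_row\<close>, 3 the maximum of the second stack, 4 the suffix maxima (indexed by the start cell of a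
  piece), and 5 and 6 (only in row 0) the predecessors and successors for the current \<open>i\<close>.
\<close>

definition load2 :: "nat \<Rightarrow> nat \<Rightarrow> nat \<Rightarrow> nat \<Rightarrow> com" where
  "load2 d a i j = Op (Mul 6 i 5) ;; Op (Add 6 6 j) ;; Op (Const d 8) ;; Op (Mul 6 6 d) ;;
     Op (Const d (64 + a)) ;; Op (Add 6 6 d) ;; Op (Load d 6)"

definition store2 :: "nat \<Rightarrow> nat \<Rightarrow> nat \<Rightarrow> nat \<Rightarrow> com" where
  "store2 a i j v = Op (Mul 6 i 5) ;; Op (Add 6 6 j) ;; Op (Const 7 8) ;; Op (Mul 6 6 7) ;;
     Op (Const 7 (64 + a)) ;; Op (Add 6 6 7) ;; Op (Store 6 v)"

text \<open>With truncated subtraction, \<open>a + (b - a)\<close> is the maximum.\<close>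

definition maximum :: "nat \<Rightarrow> nat \<Rightarrow> nat \<Rightarrow> com" where
  "maximum d a b = Op (Sub 6 b a) ;; Op (Add d a 6)"

definition mov :: "nat \<Rightarrow> nat \<Rightarrow> com" where
  "mov d a = Op (Add d a 3)"

text \<open>Register 10 holds the end position, which is at least the index in \<open>p\<close>, so
  \<open>1 - (M 10 - M p)\<close> is 1 exactly if there is no neighbour yet. The sum acts as
  disjunction and the product as conjunction. The idle \<open>mov p p\<close> equalises the running
  times of the branches.\<close>

definition update_index :: "nat \<Rightarrow> nat \<Rightarrow> nat \<Rightarrow> nat \<Rightarrow> nat \<Rightarrow> com" where
  "update_index p x y u v = Op (Leq 20 x y) ;; Op (Leq 21 u v) ;; Op (Sub 22 10 p) ;;
     Op (Sub 22 4 22) ;; Op (Add 21 21 22) ;; Op (Mul 20 20 21) ;;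
     If_Le 4 20 (mov p 14) (mov p p)"

definition index_loop :: com where
  "index_loop = While_Le 4 14 (Op (Sub 14 14 4) ;;
     update_index 15 14 10 15 14 ;; update_index 16 10 14 14 16 ;;
     store2 5 3 14 15 ;; store2 6 3 14 16)"

definition row_indices :: com where
  "row_indices = mov 15 10 ;; mov 16 10 ;; mov 14 10 ;;
     store2 5 3 14 15 ;; store2 6 3 14 16 ;; index_loop"

text \<open>Register 13 accumulates the failures of the conditions in \<open>iso_Suc_iff\<close>;
  each equivalence is tested by two opposite truncated differences.\<close>

definition match_loop :: com where
  "match_loop = While_Le 4 13 (
     Op (Sub 12 12 4) ;; Op (Sub 14 8 12) ;; load2 15 5 3 14 ;; load2 16 6 3 14 ;;
     Op (Add 17 0 11) ;; Op (Add 18 17 15) ;; Op (Sub 18 18 10) ;;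
     Op (Add 19 17 16) ;; Op (Sub 19 19 10) ;;
     Op (Leq 20 18 17) ;; Op (Leq 21 10 15) ;; Op (Leq 22 17 18) ;;
     Op (Leq 23 17 19) ;; Op (Leq 24 16 10) ;; Op (Leq 25 19 17) ;;
     Op (Sub 13 4 20) ;; Op (Sub 26 4 23) ;; maximum 13 13 26 ;;
     Op (Sub 26 21 22) ;; maximum 13 13 26 ;; Op (Sub 26 22 21) ;; maximum 13 13 26 ;;
     Op (Sub 26 24 25) ;; maximum 13 13 26 ;; Op (Sub 26 25 24) ;; maximum 13 13 26)"

text \<open>The scan starts at the old length plus 2 because its body decrements before testing; the
  first length tested is then the largest possible one.\<close>

definition find_iso_len :: com where
  "find_iso_len = load2 12 1 10 11 ;; Op (Add 12 12 4) ;; Op (Add 12 12 4) ;; mov 13 4 ;;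
     match_loop ;; store2 1 8 9 12"

definition rebuild_loop :: com where
  "rebuild_loop = While_Le 34 12 (
     Op (Sub 36 8 34) ;; Op (Sub 37 9 34) ;; load2 38 0 36 37 ;; Op (Add 38 38 0) ;;
     Op (Sub 38 38 36) ;; maximum 35 35 38 ;; store2 4 36 37 35 ;; Op (Add 34 34 4))"

definition window_max :: com where
  "window_max = load2 32 2 10 11 ;; Op (Const 39 0) ;;
     If_Le 2 12
       (Op (Sub 14 8 12) ;; Op (Sub 33 9 12) ;;
        If_Le 32 14
          (mov 34 2 ;; Op (Const 35 0) ;; rebuild_loop ;; Op (Add 32 8 4) ;; Op (Sub 32 32 2))
          (load2 39 3 10 11 ;; Op (Sub 36 8 2) ;; Op (Sub 37 9 2) ;; load2 38 0 36 37 ;;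
           Op (Add 38 38 0) ;; Op (Sub 38 38 36) ;; maximum 39 39 38 ;;
           load2 35 4 14 33 ;; maximum 35 35 39) ;;
        Op (Add 35 35 8) ;; Op (Sub 35 35 0) ;; maximum 30 30 35)
       (Op (Add 32 8 4) ;; Op (Sub 32 32 2))"

definition cell :: com where
  "cell = find_iso_len ;; load2 30 0 10 9 ;; load2 31 0 8 11 ;; maximum 30 30 31 ;; window_max ;;
     store2 0 8 9 30 ;; store2 2 8 9 32 ;; store2 3 8 9 39"

definition cell_loop :: com where
  "cell_loop = While_Le 9 1 (Op (Sub 11 9 4) ;; cell ;; Op (Add 9 9 4))"

definition row_loop :: com where
  "row_loop = While_Le 8 0 (Op (Sub 10 8 4) ;; row_indices ;; mov 9 4 ;; cell_loop ;; Op (Add 8 8 4))"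

text \<open>For \<open>m = 0\<close> the time budget is constant whatever \<open>n\<close> is, so
  this case is answered at once.\<close>

definition program :: com where
  "program = Op (Const 4 1) ;; If_Le 4 0
     (Op (Add 5 1 4) ;; mov 8 4 ;; row_loop ;; load2 0 0 0 1) (Op (Const 0 0))"

lemmas program_defs = program_def row_loop_def cell_loop_def cell_def window_max_def
  rebuild_loop_def find_iso_len_def match_loop_def row_indices_def index_loop_def update_index_def
  mov_def maximum_def load2_def store2_def

lemma com_ok_program: "com_ok program"
  by (simp add: program_defs)

locale op_lcs_ram = op_lcs +
  assumes m1: "1 \<le> m" and mn: "m \<le> n"
begin

section \<open>Resource bounds, array addressing and the basic macros\<close>

definition cells :: nat where
  "cells = 64 + 8 * ((m + 1) * (n + 1))"

text \<open>Registers hold addresses as well as \<open>k\<close>, which may exceed \<open>m\<close>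
  and \<open>n\<close>.\<close>

definition word :: nat where
  "word = 128 + cells + 8 * (m + n + k)"

sublocale ram r "X @ Y" cells word
  by unfold_locales (auto simp: cells_def word_def)

declare vc.simps(4) [simp del] sym_leq.simps [simp del]

definition addr :: "nat \<Rightarrow> nat \<Rightarrow> nat \<Rightarrow> nat" where
  "addr a i j = (i * (n + 1) + j) * 8 + (64 + a)"

lemma addr_ge: "64 \<le> addr a i j"
  by (simp add: addr_def)

lemma addr_neq [simp]: "x < 64 \<Longrightarrow> addr a i j \<noteq> x" "x < 64 \<Longrightarrow> x \<noteq> addr a i j"
  "x < 64 \<Longrightarrow> \<not> addr a i j \<le> x" "x < 64 \<Longrightarrow> x \<le> addr a i j"
  by (auto simp: addr_def)

text \<open>The residue modulo 8 recovers the array, and the residue of the quotient modulo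
  \<open>n + 1\<close> the column.\<close>

lemma addr_eq_iff [simp]:
  assumes "j \<le> n" "j' \<le> n" "a < 8" "a' < 8"
  shows "addr a i j = addr a' i' j' \<longleftrightarrow> a = a' \<and> i = i' \<and> j = j'"
proof
  assume eq: "addr a i j = addr a' i' j'"
  have "a = addr a i j mod 8" "a' = addr a' i' j' mod 8"
    using assms unfolding addr_def by presburger+
  with eq have a: "a = a'" by simp
  with eq have e: "i * (n + 1) + j = i' * (n + 1) + j'" by (simp add: addr_def)
  moreover have "(i * (n + 1) + j) mod (n + 1) = j" "(i' * (n + 1) + j') mod (n + 1) = j'"
    using assms by (simp_all del: add_Suc_right mult_Suc_right add: mod_mult_self3)
  ultimately have "j = j'" by simp
  moreover from this e have "i * (n + 1) = i' * (n + 1)" by linarith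
  then have "i = i'" by (simp only: mult_cancel2) simp
  ultimately show "a = a' \<and> i = i' \<and> j = j'" using a by simp
qed simp

lemma addr_neq_array [simp]: "a < 8 \<Longrightarrow> a' < 8 \<Longrightarrow> a \<noteq> a' \<Longrightarrow> addr a i j \<noteq> addr a' i' j'"
proof -
  have "x * 8 + (64 + a) \<noteq> y * 8 + (64 + a')" if "a < 8" "a' < 8" "a \<noteq> a'" for x y
    using that by presburger
  then show "a < 8 \<Longrightarrow> a' < 8 \<Longrightarrow> a \<noteq> a' \<Longrightarrow> ?thesis" unfolding addr_def .
qed

lemma addr_less:
  assumes "i \<le> m" "j \<le> n" "a < 8"
  shows "addr a i j < cells"
proof -
  have "i * (n + 1) + j < (m + 1) * (n + 1)"
    using mult_le_mono1[OF assms(1), of "n + 1"] assms(2) by simp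
  then show ?thesis using assms(3) by (simp add: addr_def cells_def)
qed

lemma word_gt [simp]: "x \<le> 8 * (m + n + k) + 100 \<Longrightarrow> x < word"
  by (simp add: word_def)

lemma word_flag [simp]: "flag b < word"
  by (simp add: word_def flag_def)

lemma word_max [simp]: "x < word \<Longrightarrow> y < word \<Longrightarrow> max x y < word"
  by simp

lemma word_diff [simp]: "x < word \<Longrightarrow> x - y < word"
  by simp

lemma addr_word:
  assumes "i \<le> m" "j \<le> n" "a < 8"
  shows "i * (n + 1) < word" "i * (n + 1) + j < word" "(i * (n + 1) + j) * 8 < word"
    "(i * (n + 1) + j) * 8 + (64 + a) < word"
  using addr_less[OF assms] by (simp_all add: addr_def word_def)

lemma add7: "Suc (Suc (Suc (Suc (Suc (Suc (Suc t)))))) = t + 7"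
  and add9: "Suc (Suc (Suc (Suc (Suc (Suc (Suc (Suc (Suc t)))))))) = t + 9"
  by simp_all

lemma vc_load2 [simp]:
  assumes "M 5 = n + 1" "M i \<le> m" "M j \<le> n" "a < 8" "i \<noteq> 6" "j \<noteq> 6" "d \<noteq> 6" "d < 64"
  shows "vc (load2 d a i j) Q M t \<longleftrightarrow>
    Q (M(6 := addr a (M i) (M j), d := M (addr a (M i) (M j)))) (t + 7)"
  using assms addr_word[OF assms(2-4)] addr_less[OF assms(2-4)]
    addr_neq[of d a "M i" "M j"] addr_neq[of 6 a "M i" "M j"]
  unfolding load2_def addr_def by (simp add: add7)

lemma vc_store2 [simp]:
  assumes "M 5 = n + 1" "M i \<le> m" "M j \<le> n" "a < 8" "i \<noteq> 6" "j \<noteq> 6" "v \<noteq> 6" "v \<noteq> 7" "j \<noteq> 7" "i \<noteq> 7"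
  shows "vc (store2 a i j v) Q M t \<longleftrightarrow>
    Q (M(6 := addr a (M i) (M j), 7 := 64 + a, addr a (M i) (M j) := M v)) (t + 7)"
  using assms addr_word[OF assms(2-4)] addr_less[OF assms(2-4)]
  unfolding store2_def addr_def by (simp add: fun_upd_twist[of 7 6] add7)

lemma vc_maximum [simp]:
  assumes "M a < word" "M b < word" "a \<noteq> 6"
  shows "vc (maximum d a b) Q M t \<longleftrightarrow> Q (M(6 := M b - M a, d := max (M a) (M b))) (t + 2)"
proof -
  have "M a + (M b - M a) = max (M a) (M b)" by simp
  then show ?thesis using assms unfolding maximum_def by simp
qed

lemma vc_mov [simp]:
  assumes "M a < word" "M 3 = 0"
  shows "vc (mov d a) Q M t \<longleftrightarrow> Q (M(d := M a)) (t + 1)"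
  using assms unfolding mov_def by simp

text \<open>An opaque conditional that keeps the simplifier from splitting memory states.\<close>

definition select :: "bool \<Rightarrow> nat \<Rightarrow> nat \<Rightarrow> nat" where
  "select b x y = (if b then x else y)"

lemma vc_update_index [simp]:
  assumes "M 4 = 1" "M 3 = 0" "M p < word" "M 14 < word" "p < 20" "p \<noteq> 4" "p \<noteq> 3" "p \<noteq> 14"
    "p \<noteq> 10" "M p \<le> M 10" "x < 20" "y < 20" "u < 20" "v < 20"
  shows "vc (update_index p x y u v) Q M t \<longleftrightarrow>
    Q (M(20 := flag (sym_leq r (X @ Y) (M x) (M y)) *
             (flag (sym_leq r (X @ Y) (M u) (M v)) + (1 - (M 10 - M p))),
         21 := flag (sym_leq r (X @ Y) (M u) (M v)) + (1 - (M 10 - M p)), 22 := 1 - (M 10 - M p),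
         p := select (sym_leq r (X @ Y) (M x) (M y) \<and> (M p = M 10 \<or> sym_leq r (X @ Y) (M u) (M v)))
                (M 14) (M p))) (t + 9)"
  using assms unfolding update_index_def
  by (cases "sym_leq r (X @ Y) (M x) (M y)"; cases "sym_leq r (X @ Y) (M u) (M v)"; cases "M p = M 10")
    (simp_all add: add9 flag_def select_def fun_upd_twist[of 22 21] fun_upd_twist[of 22 20] fun_upd_twist[of 21 20])

section \<open>Verification of the loops inside a cell and of the neighbour tables\<close>

definition base :: "memory \<Rightarrow> bool" where
  "base M \<longleftrightarrow> M 0 = m \<and> M 1 = n \<and> M 2 = k \<and> M 3 = 0 \<and> M 4 = 1 \<and> M 5 = n + 1"

definition indices :: "memory \<Rightarrow> nat \<Rightarrow> nat \<Rightarrow> bool" where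
  "indices M e s \<longleftrightarrow> (\<forall>s'. s \<le> s' \<and> s' \<le> e \<longrightarrow>
     pred_index r X e s' (M (addr 5 0 s')) \<and> pred_index (r\<inverse>) X e s' (M (addr 6 0 s')))"

lemma base_upd [simp]: "6 \<le> x \<Longrightarrow> base (M(x := v)) \<longleftrightarrow> base M"
  by (simp add: base_def)

lemma indices_upd [simp]: "x < 64 \<Longrightarrow> indices (M(x := v)) e s \<longleftrightarrow> indices M e s"
  by (simp add: indices_def)

lemma indices_cong: "(\<And>s. s \<le> e \<Longrightarrow> M' (addr 5 0 s) = M (addr 5 0 s) \<and> M' (addr 6 0 s) = M (addr 6 0 s)) \<Longrightarrow>
    indices M' e s0 \<longleftrightarrow> indices M e s0"
  by (simp add: indices_def)

lemma sym_leq_XX: "i < m \<Longrightarrow> j < m \<Longrightarrow> sym_leq r (X @ Y) i j \<longleftrightarrow> (X ! i, X ! j) \<in> r"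
  by (simp add: sym_leq.simps nth_append)

lemma sym_leq_YY: "i < n \<Longrightarrow> j < n \<Longrightarrow> sym_leq r (X @ Y) (m + i) (m + j) \<longleftrightarrow> (Y ! i, Y ! j) \<in> r"
  by (simp add: sym_leq.simps nth_append)

lemma vc_match_loop:
  assumes base: "base M" and ij: "Suc i \<le> m" "Suc j \<le> n"
    and M: "M 8 = Suc i" "M 9 = Suc j" "M 10 = i" "M 11 = j" "M 12 = iso_len i j + 2" "M 13 = 1"
    and ind: "indices M i 0"
  shows "vc match_loop (\<lambda>M' t'. (\<forall>a. a \<notin> {6, 7} \<union> {12..29} \<longrightarrow> M' a = M a) \<and>
      M' 12 = iso_len (Suc i) (Suc j) \<and>
      t' \<le> t + 60 * (iso_len i j + 2 - iso_len (Suc i) (Suc j)) + 2) M t"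
proof -
  let ?L = "iso_len (Suc i) (Suc j)"
  \<comment> \<open>While the flag is raised, the true length is below the current candidate.
    Initially this is \<open>?L \<le> Suc (iso_len i j)\<close>.\<close>
  define I where "I M' t' \<longleftrightarrow> (\<forall>a. a \<notin> {6, 7} \<union> {12..29} \<longrightarrow> M' a = M a) \<and>
      (if 1 \<le> M' 13 then ?L < M' 12 \<and> M' 12 \<le> iso_len i j + 2 else M' 12 = ?L) \<and>
      t' \<le> t + 60 * (iso_len i j + 2 - M' 12)" for M' t'
  have iso_len: "?L \<le> Suc (iso_len i j)" "1 \<le> ?L" "iso_len i j \<le> i" "iso_len i j \<le> j"
    using iso_len_Suc_le iso_len_Suc_ge iso_len_le[of i j] ij by auto
  have frame: "M' 0 = m \<and> M' 3 = 0 \<and> M' 4 = 1 \<and> M' 5 = n + 1 \<and> M' 8 = Suc i \<and> M' 10 = i \<and> M' 11 = j"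
    if "I M' t'" for M' t'
    using that base M by (auto simp: I_def base_def)
  show ?thesis
    unfolding match_loop_def
  proof (rule vc_WhileI[where I = I and B = "t + 60 * (iso_len i j + 2)"], goal_cases)
    case 1
    show ?case using iso_len M by (auto simp: I_def)
  next
    case (2 M' t')
    then show ?case unfolding I_def by (meson add_le_mono diff_le_self le_trans mult_le_mono2 order_refl)
  next
    case (3 M' t')
    note fr = frame[OF 3(1)]
    \<comment> \<open>After the decrement the tested length is \<open>Suc l\<close>, a one-symbol
      extension of the isomorphism of length \<open>l\<close> at \<open>(i, j)\<close>.\<close>
    define l where "l = M' 12 - 2"
    have l: "M' 12 = l + 2" "?L \<le> l + 1" "l \<le> iso_len i j"
      using 3 fr iso_len unfolding I_def l_def by auto
    define s where "s = i - l"
    define p q where "p = M (addr 5 0 s)" and "q = M (addr 6 0 s)"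
    have M': "M' (addr 5 0 s) = p" "M' (addr 6 0 s) = q"
      using 3(1) addr_ge unfolding I_def p_def q_def by auto
    have p: "pred_index r X i s p" and q: "pred_index (r\<inverse>) X i s q"
      using ind unfolding indices_def p_def q_def s_def by auto
    then have pq: "s \<le> p" "p \<le> i" "s \<le> q" "q \<le> i" by (auto simp: pred_index_def)
    have li: "l \<le> i" "l \<le> j" using l iso_len by auto
    have iso: "iso i j l" using iso_iff_le_iso_len[of i j l] ij l by auto
    let ?good = "sym_leq r (X @ Y) (m + j + p - i) (m + j) \<and>
      (sym_leq r (X @ Y) i p \<longleftrightarrow> sym_leq r (X @ Y) (m + j) (m + j + p - i)) \<and>
      sym_leq r (X @ Y) (m + j) (m + j + q - i) \<and>
      (sym_leq r (X @ Y) q i \<longleftrightarrow> sym_leq r (X @ Y) (m + j + q - i) (m + j))"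
    have eq: "m + j + p - i = m + (j + p - i)" "m + j + q - i = m + (j + q - i)"
      and "j + p - i < n" "j + q - i < n"
      using pq li ij by (auto simp: s_def)
    then have good: "?good \<longleftrightarrow> l + 1 \<le> ?L"
      unfolding eq using iso_Suc_iff[OF iso, of p q] p q ij pq iso_iff_le_iso_len[of "Suc i" "Suc j" "Suc l"]
      by (simp add: sym_leq_XX sym_leq_YY s_def)
    have b: "s \<le> n" "p \<le> m" "q \<le> m" "j \<le> n"
      using pq ij mn by (auto simp: s_def)
    have tm: "t' + 48 \<le> t + 60 * (iso_len i j + 2 - Suc l)"
      using 3(1) l unfolding I_def by (simp add: Suc_diff_le)
    show ?case
      using fr l(1) M' b
      apply (simp add: s_def[symmetric])
      apply (subst I_def)
      apply (intro conjI)
      subgoal using 3(1) unfolding I_def by simp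
      subgoal using l good by auto
      subgoal using tm by simp
      done
  next
    case (4 M' t')
    then show ?case using frame[OF 4(1)] unfolding I_def by auto
  qed
qed

lemma vc_find_iso_len:
  assumes base: "base M" and ij: "Suc i \<le> m" "Suc j \<le> n"
    and M: "M 8 = Suc i" "M 9 = Suc j" "M 10 = i" "M 11 = j" "M (addr 1 i j) = iso_len i j"
    and ind: "indices M i 0"
  shows "vc find_iso_len (\<lambda>M' t'.
      (\<forall>a. a \<notin> {6, 7} \<union> {12..29} \<and> a \<noteq> addr 1 (Suc i) (Suc j) \<longrightarrow> M' a = M a) \<and>
      M' 12 = iso_len (Suc i) (Suc j) \<and> M' (addr 1 (Suc i) (Suc j)) = iso_len (Suc i) (Suc j) \<and>
      t' \<le> t + 60 * (iso_len i j + 2 - iso_len (Suc i) (Suc j)) + 30) M t"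
proof -
  have iso_len: "iso_len i j \<le> i" using iso_len_le[of i j] ij by simp
  have b: "M 3 = 0" "M 4 = 1" "M 5 = n + 1" using base by (auto simp: base_def)
  show ?thesis
    unfolding find_iso_len_def using b M ij iso_len
    apply simp
    apply (rule vc_mono[OF vc_match_loop[where i = i and j = j]])
             apply (simp_all add: base ind)
    done
qed

text \<open>Increasing lengths are decreasing start rows, so the running maximum at each row is the
  suffix maximum up to row \<open>i - k\<close>.\<close>

lemma vc_rebuild_loop:
  assumes base: "base M" and ij: "i \<le> m" "j \<le> n"
    and M: "M 8 = i" "M 9 = j" "M 12 = L" "M 34 = k" "M 35 = 0" and L: "k \<le> L" "L \<le> i" "L \<le> j"
    and opt: "\<And>x. k \<le> x \<Longrightarrow> x \<le> L \<Longrightarrow> M (addr 0 (i - x) (j - x)) = opt (i - x) (j - x)"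
  shows "vc rebuild_loop (\<lambda>M' t'.
      (\<forall>a. a \<notin> {6, 7} \<union> {34..38} \<and> (\<forall>y. k \<le> y \<and> y \<le> L \<longrightarrow> a \<noteq> addr 4 (i - y) (j - y)) \<longrightarrow> M' a = M a) \<and>
      (\<forall>y. k \<le> y \<and> y \<le> L \<longrightarrow> M' (addr 4 (i - y) (j - y)) = diag_max i j k y) \<and>
      M' 35 = diag_max i j k L \<and> t' \<le> t + 40 * (L + 1 - k) + 2) M t"
proof -
  define I where "I M' t' \<longleftrightarrow> k \<le> M' 34 \<and> M' 34 \<le> L + 1 \<and> M' 35 = diag_max i j k (M' 34 - 1) \<and>
      (\<forall>a. a \<notin> {6, 7} \<union> {34..38} \<and> (\<forall>y. k \<le> y \<and> y < M' 34 \<longrightarrow> a \<noteq> addr 4 (i - y) (j - y)) \<longrightarrow> M' a = M a) \<and>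
      (\<forall>y. k \<le> y \<and> y < M' 34 \<longrightarrow> M' (addr 4 (i - y) (j - y)) = diag_max i j k y) \<and>
      t' \<le> t + 40 * (M' 34 - k)" for M' t'
  have frame: "M' 0 = m \<and> M' 3 = 0 \<and> M' 4 = 1 \<and> M' 5 = n + 1 \<and> M' 8 = i \<and> M' 9 = j \<and> M' 12 = L"
    if "I M' t'" for M' t'
    using that base M by (auto simp: I_def base_def)
  have start_val: "start_val s u \<le> m + m" if "s \<le> m" for s u
    using that opt_le[of s u] by (simp add: start_val_def)
  have diag_max: "diag_max i j k x \<le> m + m" for x
    unfolding diag_max_def using start_val ij by auto
  show ?thesis
    unfolding rebuild_loop_def
  proof (rule vc_WhileI[where I = I and B = "t + 40 * (L + 1 - k)"], goal_cases)
    case 1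
    show ?case using M L k1 by (simp add: I_def diag_max_empty)
  next
    case (2 M' t')
    then have "40 * (M' 34 - k) \<le> 40 * (L + 1 - k)" unfolding I_def by (auto intro: diff_le_mono)
    then show ?case using 2 unfolding I_def by linarith
  next
    case (3 M' t')
    note fr = frame[OF 3(1)]
    define x where "x = M' 34"
    have x: "k \<le> x" "x \<le> L" "M' 34 = x" using 3 fr unfolding I_def x_def by auto
    define s u where "s = i - x" and "u = j - x"
    have su: "s \<le> m" "u \<le> n" "i - x = s" "j - x = u" using ij by (auto simp: s_def u_def)
    have run: "M' 35 = diag_max i j k (x - 1)" using 3(1) x unfolding I_def by simp
    have C: "M' (addr 0 s u) = opt s u"
      using 3(1) opt[OF x(1,2)] ij su unfolding I_def by auto
    have v: "opt s u + m - s = start_val s u" "opt s u \<le> m"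
      using su opt_le[of s u] by (auto simp: start_val_def)
    have b: "start_val s u < word" "diag_max i j k (x - 1) < word" "max (diag_max i j k (x - 1)) (start_val s u) = diag_max i j k x"
      using start_val[OF su(1), of u] diag_max[of "x - 1"] diag_max_snoc[of k "x - 1" i j] x k1 su by auto
    have tm: "t' + 40 \<le> t + 40 * (Suc x - k)"
      using 3(1) x unfolding I_def by (simp add: Suc_diff_le)
    have xw: "x \<le> m" using x L ij by simp
    have neq: "addr 4 (i - y) (j - y) \<noteq> addr 4 s u" if "k \<le> y" "y < x" for y
    proof -
      have "i - y \<noteq> s" using that x(2) L(2) unfolding s_def by linarith
      moreover have "j - y \<le> n" using ij by simp
      ultimately show ?thesis using su(2) by simp
    qed
    show ?case
      using fr x(3) su run C v b xw
      apply simp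
      apply (subst I_def)
      apply (intro conjI)
      subgoal using x by simp
      subgoal using x by simp
      subgoal by simp
      subgoal using 3(1) x unfolding I_def by (auto simp: less_Suc_eq)
      subgoal using 3(1) x neq unfolding I_def by (auto simp: less_Suc_eq)
      subgoal using tm by simp
      done
  next
    case (4 M' t')
    then have "M' 34 = L + 1" using frame[OF 4(1)] unfolding I_def by auto
    then show ?case using 4(1) unfolding I_def by (auto simp: less_Suc_eq_le)
  qed
qed

text \<open>The three cases are an empty window, a rebuild and a kept queue. The frame condition
  records that suffix maxima are written only in a rebuild, which \<open>tables_step\<close> relies
  on.\<close>

lemma vc_window_max:
  assumes base: "base M" and ij: "Suc i \<le> m" "Suc j \<le> n" and L: "L = iso_len (Suc i) (Suc j)"
    and M: "M 8 = Suc i" "M 9 = Suc j" "M 10 = i" "M 11 = j" "M 12 = L"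
      "M 30 = max (opt i (Suc j)) (opt (Suc i) j)"
    and opt: "\<And>x. k \<le> x \<Longrightarrow> x \<le> L \<Longrightarrow> M (addr 0 (Suc i - x) (Suc j - x)) = opt (Suc i - x) (Suc j - x)"
    and E: "M (addr 2 i j) = split_row i j" and Q: "queue i j (M (addr 3 i j)) (\<lambda>s u. M (addr 4 s u))"
  shows "vc window_max (\<lambda>M' t'.
      (\<forall>a. a \<notin> {6, 7, 14} \<union> {30..39} \<and>
         (\<forall>y. k \<le> y \<and> y \<le> L \<and> split_row i j \<le> Suc i - L \<longrightarrow> a \<noteq> addr 4 (Suc i - y) (Suc j - y)) \<longrightarrow> M' a = M a) \<and>
      M' 30 = opt (Suc i) (Suc j) \<and> M' 32 = split_row (Suc i) (Suc j) \<and>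
      queue (Suc i) (Suc j) (M' 39) (\<lambda>s u. M' (addr 4 s u)) \<and>
      t' \<le> t + 60 * (split_row (Suc i) (Suc j) - split_row i j) + 90) M t"
proof -
  have b: "M 0 = m" "M 2 = k" "M 3 = 0" "M 4 = 1" "M 5 = n + 1" using base by (auto simp: base_def)
  have Lb: "L \<le> Suc i" "L \<le> Suc j" using iso_len_le[of "Suc i" "Suc j"] ij L by auto
  have start_val: "start_val s u \<le> m + m" if "s \<le> m" for s u
    using that opt_le[of s u] by (simp add: start_val_def)
  have diag_max: "diag_max (Suc i) (Suc j) k x \<le> m + m" for x
    unfolding diag_max_def using start_val ij by auto
  have om: "max (opt i (Suc j)) (opt (Suc i) j) < word"
    using opt_le[of i "Suc j"] opt_le[of "Suc i" j] ij by (intro word_gt) simp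
  have w: "diag_max (Suc i) (Suc j) k L + Suc i < word" using diag_max[of L] ij by simp
  define e where "e = split_row (Suc i) (Suc j)"
  define o' where "o' = opt (Suc i) (Suc j)"
  have o': "o' = max (max (opt i (Suc j)) (opt (Suc i) j))
      (if k \<le> L then diag_max (Suc i) (Suc j) k L + Suc i - m else 0)"
    using opt_rec[of "Suc i" "Suc j"] ij L by (simp add: o'_def)
  consider "\<not> k \<le> L" | "k \<le> L" "split_row i j \<le> Suc i - L" | "k \<le> L" "Suc i - L < split_row i j"
    by linarith
  then show ?thesis
  proof cases
    case 1
    have e: "e = Suc (Suc i) - k" using 1 L by (simp add: e_def)
    have q: "queue (Suc i) (Suc j) pre suf" for pre suf using 1 L by (simp add: queue_def)
    show ?thesis
      unfolding window_max_def e_def[symmetric] o'_def[symmetric]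
      using b M E ij om 1 o' e q by (simp del: split_row.simps)
  next
    case 2
    have e: "e = Suc (Suc i) - k" using 2 L by (simp add: e_def)
    \<comment> \<open>The rebuild is paid for by the jump of \<open>split_row\<close>: the old value
      is at most the first row \<open>Suc i - L\<close> of the window, the new one is one past its
      last row.\<close>
    have ee: "L + 1 - k \<le> e - split_row i j" using 2 e Lb by linarith
    let ?o = "diag_max (Suc i) (Suc j) k L"
    show ?thesis
      unfolding window_max_def e_def[symmetric] o'_def[symmetric]
      using b M E ij om 2
      apply (simp del: split_row.simps)
      apply (rule vc_mono[OF vc_rebuild_loop[where i = "Suc i" and j = "Suc j" and L = L]])
                    apply (simp_all add: base opt Lb del: split_row.simps)
      subgoal premises p for M' t'
      proof -
        have frame: "M' a = (M(6 := addr 2 i j, 32 := split_row i j, 39 := 0, 14 := Suc i - L, 33 := Suc j - L, 34 := k, 35 := 0)) a"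
          if "a \<notin> {6, 7} \<union> {34..38}" "\<forall>y. k \<le> y \<and> y \<le> L \<longrightarrow> a \<noteq> addr 4 (Suc i - y) (Suc j - y)" for a
          using p that by simp
        have M': "M' 0 = m" "M' 2 = k" "M' 4 = 1" "M' 8 = Suc i" "M' 30 = max (opt i (Suc j)) (opt (Suc i) j)"
          "M' 39 = 0"
          by (subst frame; simp add: b M)+
        have M'35: "M' 35 = ?o" and tm: "t' \<le> 18 + (t + 40 * (Suc L - k))" using p by auto
        have q: "queue (Suc i) (Suc j) 0 (\<lambda>s u. M' (addr 4 s u))"
        proof (rule queue_rebuild)
          show "split_row (Suc i) (Suc j) = Suc (Suc i) - k" using e unfolding e_def .
          show "iso_len (Suc i) (Suc j) \<le> Suc i" using Lb L by simp
          show "M' (addr 4 (Suc i - x) (Suc j - x)) = diag_max (Suc i) (Suc j) k x"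
            if "k \<le> x" "x \<le> iso_len (Suc i) (Suc j)" for x
            using p that unfolding L[symmetric] by blast
        qed
        have o2: "max (max (opt i (Suc j)) (opt (Suc i) j)) (Suc (?o + i) - m) = o'"
          using o' 2 by simp
        have w': "Suc (?o + i) < word" using w by simp
        have tm': "t' + 8 \<le> t + 60 * (e - split_row i j) + 90" using tm ee by linarith
        show ?thesis
          using w' om M'(5,6) o2 q tm'
          apply (simp add: word_diff del: word_gt)
          apply (intro conjI allI impI)
          subgoal for a by (subst frame) auto
          subgoal using e by simp
          done
      qed
      done
  next
    case 3
    have e: "e = split_row i j" using 3 L by (simp add: e_def)
    define s u s2 u2 where "s = Suc i - L" and "u = Suc j - L" and "s2 = Suc i - k" and "u2 = Suc j - k"
    have su: "Suc i - L = s" "Suc j - L = u" "Suc i - k = s2" "Suc j - k = u2"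
      by (auto simp: s_def u_def s2_def u2_def)
    have le: "s \<le> m" "u \<le> n" "s2 \<le> m" "u2 \<le> n"
      using ij k1 by (auto simp: s_def u_def s2_def u2_def)
    define pre suf where "pre = M (addr 3 i j)" and "suf = M (addr 4 s u)"
    have O: "M (addr 0 s2 u2) = opt s2 u2" using opt[of k] 3 su by simp
    have v: "opt s2 u2 + m - s2 = start_val s2 u2" "opt s2 u2 \<le> m"
      using le opt_le[of s2 u2] by (auto simp: start_val_def)
    note keep = queue_keep[OF Q ij L 3, unfolded su, folded pre_def suf_def]
    have bd: "start_val s2 u2 \<le> m + m" "pre \<le> m + m" "suf \<le> m + m" using diag_max[of L] unfolding keep(3) by auto
    have bd': "start_val s2 u2 < word" "pre < word" "suf < word" using bd by auto
    define b1 b2 b3 where "b1 = max (opt i (Suc j)) (opt (Suc i) j)" and "b2 = max pre (start_val s2 u2)"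
      and "b3 = max suf b2"
    have b': "max (opt i (Suc j)) (opt (Suc i) j) = b1" "max pre (start_val s2 u2) = b2" "max suf b2 = b3"
      by (simp_all add: b1_def b2_def b3_def)
    have diag_max3: "diag_max (Suc i) (Suc j) k L = b3" using keep(3) by (simp add: b2_def b3_def)
    have w': "Suc (b3 + i) < word" using w unfolding diag_max3 by simp
    have o2: "max b1 (Suc (b3 + i) - m) = o'"
      using o' 3 diag_max3 unfolding b' by simp
    have k: "k \<le> L" "\<not> split_row i j \<le> s" using 3 su by auto
    have om': "b1 < word" "b2 < word" using om bd' unfolding b1_def b2_def by auto
    have ij': "i \<le> m" "j \<le> n" and vw: "opt s2 u2 + m < word" using ij v(2) by auto
    have M30: "M 30 = b1" using M(6) unfolding b' .
    have q: "queue (Suc i) (Suc j) b2 (\<lambda>s u. M (addr 4 s u))" using keep(2) unfolding b' .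
    show ?thesis
      unfolding window_max_def e_def[symmetric] o'_def[symmetric]
      by (simp add: b M(1-5) M30 E ij' k su le O v vw bd' w' pre_def[symmetric] suf_def[symmetric]
          o2 om' b'(2,3) q e del: split_row.simps word_gt)
  qed
qed

lemma vc_index_loop:
  assumes base: "base M" and e: "e < m" and M: "M 10 = e" "M 14 = e" "M 15 = e" "M 16 = e"
    and ind: "indices M e e"
  shows "vc index_loop (\<lambda>M' t'.
      (\<forall>a. a \<notin> {6, 7} \<union> {14..29} \<and> (\<forall>s\<le>e. a \<noteq> addr 5 0 s \<and> a \<noteq> addr 6 0 s) \<longrightarrow> M' a = M a) \<and>
      indices M' e 0 \<and> t' \<le> t + 80 * e + 2) M t"
proof -
  define I where "I M' t' \<longleftrightarrow> M' 14 \<le> e \<and>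
      (\<forall>a. a \<notin> {6, 7} \<union> {14..29} \<and> (\<forall>s\<le>e. a \<noteq> addr 5 0 s \<and> a \<noteq> addr 6 0 s) \<longrightarrow> M' a = M a) \<and>
      pred_index r X e (M' 14) (M' 15) \<and> pred_index (r\<inverse>) X e (M' 14) (M' 16) \<and>
      indices M' e (M' 14) \<and> t' \<le> t + 80 * (e - M' 14)" for M' t'
  have frame: "M' 3 = 0 \<and> M' 4 = 1 \<and> M' 5 = n + 1 \<and> M' 10 = e" if "I M' t'" for M' t'
    using that base M by (auto simp: I_def base_def)
  show ?thesis
    unfolding index_loop_def
  proof (rule vc_WhileI[where I = I and B = "t + 80 * e"], goal_cases)
    case 1
    show ?case using M ind pred_index_self[OF e] by (simp add: I_def)
  next
    case (2 M' t')
    have "80 * (e - M' 14) \<le> 80 * e" by simp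
    then show ?case using 2 unfolding I_def by linarith
  next
    case (3 M' t')
    note fr = frame[OF 3(1)]
    obtain s where s: "M' 14 = Suc s" using 3 fr by (cases "M' 14") auto
    define p q where "p = M' 15" and "q = M' 16"
    have I: "Suc s \<le> e" "pred_index r X e (Suc s) p" "pred_index (r\<inverse>) X e (Suc s) q"
      "indices M' e (Suc s)" "t' \<le> t + 80 * (e - Suc s)"
      using 3(1) unfolding I_def s p_def q_def by auto
    define p' q' where "p' = select (sym_leq r (X @ Y) s e \<and> (p = e \<or> sym_leq r (X @ Y) p s)) s p"
      and "q' = select (sym_leq r (X @ Y) e s \<and> (q = e \<or> sym_leq r (X @ Y) s q)) s q"
    have pq: "p \<le> e" "q \<le> e" using I by (auto simp: pred_index_def)
    have p': "pred_index r X e s p'"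
      using pred_index_step[OF I(2)] I(1) e pq unfolding p'_def select_def by (simp add: sym_leq_XX)
    have q': "pred_index (r\<inverse>) X e s q'"
      using succ_index_step[OF I(3)] I(1) e pq unfolding q'_def select_def by (simp add: sym_leq_XX)
    have b: "s \<le> m" "s \<le> n" "p < word" "q < word" "s < word" "p' < word" "q' < word"
      using I(1) e mn pq p' q' by (auto simp: pred_index_def)
    have I6: "\<forall>a. a \<notin> {6, 7} \<union> {14..29} \<and> (\<forall>s\<le>e. a \<noteq> addr 5 0 s \<and> a \<noteq> addr 6 0 s) \<longrightarrow> M' a = M a"
      using 3(1) unfolding I_def by blast
    have ind': "indices M'' e (M'' 14)" if "M'' 14 = s" "\<And>x. x \<le> e \<Longrightarrow> M'' (addr 5 0 x) = (if x = s then p' else M' (addr 5 0 x))"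
      "\<And>x. x \<le> e \<Longrightarrow> M'' (addr 6 0 x) = (if x = s then q' else M' (addr 6 0 x))" for M''
      unfolding indices_def that(1)
    proof (intro allI impI)
      fix x assume "s \<le> x \<and> x \<le> e"
      then show "pred_index r X e x (M'' (addr 5 0 x)) \<and> pred_index (r\<inverse>) X e x (M'' (addr 6 0 x))"
        using I(4) p' q' that(2,3)[of x] unfolding indices_def by (cases "x = s") auto
    qed
    have tm: "t' + 70 \<le> t + 80 * (e - s)" using I(1,5) by linarith
    show ?case
      apply (simp add: fr s p_def[symmetric] q_def[symmetric] pq b p'_def[symmetric] q'_def[symmetric])
      apply (subst I_def)
      apply (intro conjI)
      subgoal using I(1) by simp
      subgoal using I6 I(1) by simp
      subgoal using p' by simp
      subgoal using q' by simp
      subgoal by (rule ind') (use b e mn in simp_all)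
      subgoal using tm by simp
      done
  next
    case (4 M' t')
    then have "M' 14 = 0" using frame[OF 4(1)] unfolding I_def by auto
    then show ?case using 4(1) unfolding I_def by auto
  qed
qed

lemma vc_row_indices:
  assumes base: "base M" and e: "e < m" and M: "M 10 = e"
  shows "vc row_indices (\<lambda>M' t'.
      (\<forall>a. a \<notin> {6, 7} \<union> {14..29} \<and> (\<forall>s\<le>e. a \<noteq> addr 5 0 s \<and> a \<noteq> addr 6 0 s) \<longrightarrow> M' a = M a) \<and>
      indices M' e 0 \<and> t' \<le> t + 80 * e + 30) M t"
proof -
  have b: "M 3 = 0" "M 5 = n + 1" using base by (auto simp: base_def)
  \<comment> \<open>By \<open>m \<le> n\<close>, positions of \<open>X\<close> are valid columns of
    row 0.\<close>
  have le: "e \<le> m" "e \<le> n" "e < word" using e mn by auto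
  have ind: "indices M' e e" if "M' (addr 5 0 e) = e" "M' (addr 6 0 e) = e" for M'
    using that pred_index_self[OF e] unfolding indices_def by (metis le_antisym)
  show ?thesis
    unfolding row_indices_def using b M le
    apply simp
    apply (rule vc_mono[OF vc_index_loop[where e = e]])
          apply (simp_all add: ind base e)
    done
qed

section \<open>Row-by-row table invariant and total running time\<close>

definition tables :: "memory \<Rightarrow> nat \<Rightarrow> nat \<Rightarrow> bool" where
  "tables M i j \<longleftrightarrow> (\<forall>i' j'. i' \<le> m \<and> j' \<le> n \<and> (i' < i \<or> j' = 0 \<or> i' = i \<and> j' < j) \<longrightarrow>
     M (addr 0 i' j') = opt i' j' \<and> M (addr 1 i' j') = iso_len i' j' \<and> M (addr 2 i' j') = split_row i' j' \<and>
     queue i' j' (M (addr 3 i' j')) (\<lambda>s u. M (addr 4 s u)))"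

lemma tablesD:
  assumes "tables M i j" "i' \<le> m" "j' \<le> n" "i' < i \<or> j' = 0 \<or> i' = i \<and> j' < j"
  shows "M (addr 0 i' j') = opt i' j'" "M (addr 1 i' j') = iso_len i' j'" "M (addr 2 i' j') = split_row i' j'"
    "queue i' j' (M (addr 3 i' j')) (\<lambda>s u. M (addr 4 s u))"
  using assms unfolding tables_def by blast+

lemma tables_cong:
  assumes "tables M i j"
    and eq: "\<And>a i j. a < 5 \<Longrightarrow> i \<le> m \<Longrightarrow> j \<le> n \<Longrightarrow> M' (addr a i j) = M (addr a i j)"
  shows "tables M' i j"
  unfolding tables_def
proof (intro allI impI)
  fix i' j' assume ij: "i' \<le> m \<and> j' \<le> n \<and> (i' < i \<or> j' = 0 \<or> i' = i \<and> j' < j)"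
  then have "queue i' j' (M (addr 3 i' j')) (\<lambda>s u. M (addr 4 s u))"
    using tablesD(4)[OF assms(1)] by blast
  then have "queue i' j' (M (addr 3 i' j')) (\<lambda>s u. M' (addr 4 s u))"
    by (rule queue_cong) (rule eq; use ij in auto)
  then show "M' (addr 0 i' j') = opt i' j' \<and> M' (addr 1 i' j') = iso_len i' j' \<and>
      M' (addr 2 i' j') = split_row i' j' \<and> queue i' j' (M' (addr 3 i' j')) (\<lambda>s u. M' (addr 4 s u))"
    using tablesD[OF assms(1), of i' j'] ij eq by simp
qed

text \<open>Zeroed memory already represents row 0 and all of column 0: every value there is 0, and
  \<open>iso_len = 0 < k\<close> makes the queue condition vacuous.\<close>

lemma tables_init:
  assumes "\<And>a. 64 \<le> a \<Longrightarrow> M a = 0"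
  shows "tables M 1 1"
  unfolding tables_def
proof (intro allI impI)
  fix i j assume ij: "i \<le> m \<and> j \<le> n \<and> (i < 1 \<or> j = 0 \<or> i = 1 \<and> j < 1)"
  then have "i = 0 \<or> j = 0" by auto
  moreover from this have "iso_len i j = 0" using iso_len_le[of i j] ij by auto
  ultimately show "M (addr 0 i j) = opt i j \<and> M (addr 1 i j) = iso_len i j \<and>
      M (addr 2 i j) = split_row i j \<and> queue i j (M (addr 3 i j)) (\<lambda>s u. M (addr 4 s u))"
    using assms addr_ge k1 by (cases i; cases j) (auto simp: queue_def)
qed

lemma tables_next_row: "tables M i (Suc n) \<Longrightarrow> tables M (Suc i) 1"
proof -
  assume T: "tables M i (Suc n)"
  show ?thesis
    unfolding tables_def
  proof (intro allI impI)
    fix i' j' assume ij: "i' \<le> m \<and> j' \<le> n \<and> (i' < Suc i \<or> j' = 0 \<or> i' = Suc i \<and> j' < 1)"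
    then have "i' < i \<or> j' = 0 \<or> i' = i \<and> j' < Suc n" by auto
    then show "M (addr 0 i' j') = opt i' j' \<and> M (addr 1 i' j') = iso_len i' j' \<and>
        M (addr 2 i' j') = split_row i' j' \<and> queue i' j' (M (addr 3 i' j')) (\<lambda>s u. M (addr 4 s u))"
      using tablesD[OF T, of i' j'] ij by blast
  qed
qed

text \<open>A suffix maximum is never overwritten while some cell may still need it: a rebuild at
  \<open>(Suc i, Suc j)\<close> only touches rows at or beyond \<open>split_row i j\<close>, whereas the queues of earlier
  cells of the diagonal only use rows below their own \<open>split_row\<close>, which is at most \<open>split_row i j\<close>.\<close>

lemma tables_step:
  assumes T: "tables M (Suc i) (Suc j)" and ij: "Suc i \<le> m" "Suc j \<le> n" and L: "L = iso_len (Suc i) (Suc j)"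
    and old: "\<And>a i' j'. a < 4 \<Longrightarrow> i' \<le> m \<Longrightarrow> j' \<le> n \<Longrightarrow> i' \<noteq> Suc i \<or> j' \<noteq> Suc j \<Longrightarrow>
      M' (addr a i' j') = M (addr a i' j')"
    and suf: "\<And>s u. s \<le> m \<Longrightarrow> u \<le> n \<Longrightarrow>
      (\<And>y. k \<le> y \<Longrightarrow> y \<le> L \<Longrightarrow> split_row i j \<le> Suc i - L \<Longrightarrow> s \<noteq> Suc i - y \<or> u \<noteq> Suc j - y) \<Longrightarrow>
      M' (addr 4 s u) = M (addr 4 s u)"
    and new: "M' (addr 0 (Suc i) (Suc j)) = opt (Suc i) (Suc j)" "M' (addr 1 (Suc i) (Suc j)) = iso_len (Suc i) (Suc j)"
      "M' (addr 2 (Suc i) (Suc j)) = split_row (Suc i) (Suc j)"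
      "queue (Suc i) (Suc j) (M' (addr 3 (Suc i) (Suc j))) (\<lambda>s u. M' (addr 4 s u))"
  shows "tables M' (Suc i) (Suc (Suc j))"
  unfolding tables_def
proof (intro allI impI)
  fix i' j' assume *: "i' \<le> m \<and> j' \<le> n \<and> (i' < Suc i \<or> j' = 0 \<or> i' = Suc i \<and> j' < Suc (Suc j))"
  show "M' (addr 0 i' j') = opt i' j' \<and> M' (addr 1 i' j') = iso_len i' j' \<and>
      M' (addr 2 i' j') = split_row i' j' \<and> queue i' j' (M' (addr 3 i' j')) (\<lambda>s u. M' (addr 4 s u))"
  proof (cases "i' = Suc i \<and> j' = Suc j")
    case True
    then show ?thesis using new by simp
  next
    case False
    then have d: "i' \<le> m" "j' \<le> n" "i' < Suc i \<or> j' = 0 \<or> i' = Suc i \<and> j' < Suc j" using * by auto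
    have "queue i' j' (M (addr 3 i' j')) (\<lambda>s u. M' (addr 4 s u))"
    proof (rule queue_cong[OF tablesD(4)[OF T d]])
      fix x assume x: "k \<le> iso_len i' j'" "i' - split_row i' j' < x" "x \<le> iso_len i' j'"
      have x': "x \<le> i'" "x \<le> j'" "1 \<le> j'" using x iso_len_le[of i' j'] d k1 by auto
      show "M' (addr 4 (i' - x) (j' - x)) = M (addr 4 (i' - x) (j' - x))"
      proof (rule suf)
        fix y assume y: "k \<le> y" "y \<le> L" "split_row i j \<le> Suc i - L"
        show "i' - x \<noteq> Suc i - y \<or> j' - x \<noteq> Suc j - y"
        proof (rule ccontr)
          assume "\<not> ?thesis"
          then have eq: "i' - x = Suc i - y" "j' - x = Suc j - y" by auto
          have y': "y \<le> Suc i" "y \<le> Suc j" using y L iso_len_le[of "Suc i" "Suc j"] ij by auto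
          have diag: "i' + Suc j = j' + Suc i" using eq x' y' by linarith
          then have "i' \<le> i" using d x' by linarith
          then obtain c where c: "i = i' + c" using le_Suc_ex by blast
          then have "j = j' + c" using diag by simp
          then have "split_row i' j' \<le> split_row i j" using split_row_add_mono[of i' j' c] c by simp
          then show False using eq(1) y x x' by linarith
        qed
      qed (use d in auto)
    qed
    then show ?thesis using tablesD[OF T d] old[OF _ d(1,2)] False by simp
  qed
qed

text \<open>A constant plus the increments of the two potentials along the diagonal: the first one
  pays for the length scan, the second for the rebuild.\<close>

definition cost :: "nat \<Rightarrow> nat \<Rightarrow> nat" where
  "cost i j = 300 + 60 * ((Suc i - iso_len (Suc i) (Suc j)) - (i - iso_len i j)) +
     60 * (split_row (Suc i) (Suc j) - split_row i j)"

lemma vc_cell: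
  assumes base: "base M" and ij: "Suc i \<le> m" "Suc j \<le> n"
    and M: "M 8 = Suc i" "M 9 = Suc j" "M 10 = i" "M 11 = j"
    and T: "tables M (Suc i) (Suc j)" and ind: "indices M i 0"
  shows "vc cell (\<lambda>M' t'. base M' \<and> M' 8 = Suc i \<and> M' 9 = Suc j \<and> M' 10 = i \<and>
      tables M' (Suc i) (Suc (Suc j)) \<and> indices M' i 0 \<and> t' \<le> t + cost i j) M t"
proof -
  define L where "L = iso_len (Suc i) (Suc j)"
  have iso_len: "L \<le> Suc (iso_len i j)" "L \<le> Suc i" "L \<le> Suc j" "iso_len i j \<le> i"
    using iso_len_Suc_le[of i j] iso_len_le[of "Suc i" "Suc j"] iso_len_le[of i j] ij by (auto simp: L_def)
  have ij': "i \<le> m" "j \<le> n" using ij by auto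
  \<comment> \<open>The number of tested lengths is one more than the advance of the first row of
    the window.\<close>
  have tm: "60 * (iso_len i j + 2 - L) = 60 * ((Suc i - L) - (i - iso_len i j)) + 60"
    using iso_len by simp
  have old: "M (addr 0 (Suc i - x) (Suc j - x)) = opt (Suc i - x) (Suc j - x)" if "1 \<le> x" "x \<le> L" for x
    by (rule tablesD(1)[OF T]) (use ij that in auto)
  have old': "M (addr 0 i (Suc j)) = opt i (Suc j)" "M (addr 0 (Suc i) j) = opt (Suc i) j"
    by (rule tablesD(1)[OF T]; use ij in simp)+
  have prev: "M (addr 1 i j) = iso_len i j" "M (addr 2 i j) = split_row i j"
    "queue i j (M (addr 3 i j)) (\<lambda>s u. M (addr 4 s u))"
    by (rule tablesD[OF T]; use ij in simp)+
  have w: "opt i (Suc j) < word" "opt (Suc i) j < word"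
    using opt_le[of i "Suc j"] opt_le[of "Suc i" j] ij by auto
  show ?thesis
    unfolding cell_def
    apply (subst vc.simps(2))
    apply (rule vc_mono[OF vc_find_iso_len[OF base ij M prev(1) ind]])
    subgoal premises p1 for M1 t1
    proof -
      have f1: "M1 a = M a" if "a \<notin> {6, 7} \<union> {12..29}" "a \<noteq> addr 1 (Suc i) (Suc j)" for a
        using p1 that by blast
      have L1: "M1 12 = L" "M1 (addr 1 (Suc i) (Suc j)) = L" "t1 \<le> t + 60 * (iso_len i j + 2 - L) + 30"
        using p1 unfolding L_def by auto
      have base1: "base M1" using base unfolding base_def by (simp add: f1)
      have b1: "M1 5 = n + 1" using base1 by (simp add: base_def)
      have r1: "M1 8 = Suc i" "M1 9 = Suc j" "M1 10 = i" "M1 11 = j" using M by (simp_all add: f1)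
      have q1: "queue i j (M1 (addr 3 i j)) (\<lambda>s u. M1 (addr 4 s u))"
        using queue_cong[OF prev(3), of "\<lambda>s u. M1 (addr 4 s u)"] ij by (simp add: f1)
      have o1: "M1 (addr 0 (Suc i - x) (Suc j - x)) = opt (Suc i - x) (Suc j - x)" if "k \<le> x" "x \<le> L" for x
        using old[of x] that k1 ij by (simp add: f1)
      have o1': "M1 (addr 0 i (Suc j)) = opt i (Suc j)" "M1 (addr 0 (Suc i) j) = opt (Suc i) j"
        "M1 (addr 2 i j) = split_row i j"
        using old' prev(2) ij by (simp_all add: f1)
      show ?thesis
        apply (simp add: b1 r1 ij ij' o1' w)
        apply (rule vc_mono[OF vc_window_max[where i = i and j = j and L = L]])
                     apply (simp_all add: base1 ij L_def[symmetric] r1 L1(1) o1 o1' q1 del: split_row.simps)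
        subgoal premises p2 for M2 t2
        proof -
          have f2: "M2 a = M1 a"
            if "a \<notin> {6, 7, 14} \<union> {30..39}"
              "\<And>y. k \<le> y \<Longrightarrow> y \<le> L \<Longrightarrow> split_row i j \<le> Suc i - L \<Longrightarrow> a \<noteq> addr 4 (Suc i - y) (Suc j - y)" for a
          proof -
            have "a \<noteq> 6" "a \<noteq> 30" "a \<noteq> 31" using that(1) by auto
            then show ?thesis using p2[THEN conjunct1, rule_format, of a] that by simp
          qed
          have new: "M2 30 = opt (Suc i) (Suc j)" "M2 32 = split_row (Suc i) (Suc j)"
            "queue (Suc i) (Suc j) (M2 39) (\<lambda>s u. M2 (addr 4 s u))"
            "t2 \<le> t1 + 16 + 60 * (split_row (Suc i) (Suc j) - split_row i j) + 90"
            using p2[THEN conjunct2] by (simp_all del: split_row.simps)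
          have r2: "M2 5 = n + 1" "M2 8 = Suc i" "M2 9 = Suc j" "M2 10 = i"
            by (simp_all add: f2 b1 r1)
          have base2: "base M2" using base1 unfolding base_def by (simp add: f2)
          have a1: "M1 (addr a i' j') = M (addr a i' j')"
            if "a < 8" "j' \<le> n" "a \<noteq> 1 \<or> i' \<noteq> Suc i \<or> j' \<noteq> Suc j" for a i' j'
            by (rule f1) (use that ij in auto)
          have a2: "M2 (addr a i' j') = M1 (addr a i' j')" if "a < 8" "a \<noteq> 4" for a i' j'
            by (rule f2) (use that in auto)
          have s2: "M2 (addr 4 s u) = M1 (addr 4 s u)" if "u \<le> n"
            "\<And>y. k \<le> y \<Longrightarrow> y \<le> L \<Longrightarrow> split_row i j \<le> Suc i - L \<Longrightarrow> s \<noteq> Suc i - y \<or> u \<noteq> Suc j - y" for s u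
          proof (rule f2)
            fix y assume "k \<le> y" "y \<le> L" "split_row i j \<le> Suc i - L"
            from that(2)[OF this] that(1) ij show "addr 4 s u \<noteq> addr 4 (Suc i - y) (Suc j - y)"
              by simp
          qed simp
          have fin: "tables M3 (Suc i) (Suc (Suc j)) \<and> indices M3 i 0"
            if M3: "\<And>a i' j'. a < 8 \<Longrightarrow> j' \<le> n \<Longrightarrow> M3 (addr a i' j') =
              (if i' = Suc i \<and> j' = Suc j \<and> a = 0 then opt (Suc i) (Suc j)
               else if i' = Suc i \<and> j' = Suc j \<and> a = 2 then split_row (Suc i) (Suc j)
               else if i' = Suc i \<and> j' = Suc j \<and> a = 3 then M2 39 else M2 (addr a i' j'))" for M3
          proof
            have q: "queue (Suc i) (Suc j) (M2 39) (\<lambda>s u. M3 (addr 4 s u))"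
              by (rule queue_cong[OF new(3)]) (subst M3, use ij in auto)
            show "tables M3 (Suc i) (Suc (Suc j))"
            proof (rule tables_step[OF T ij L_def])
              show "M3 (addr a i' j') = M (addr a i' j')"
                if "a < 4" "i' \<le> m" "j' \<le> n" "i' \<noteq> Suc i \<or> j' \<noteq> Suc j" for a i' j'
              proof -
                have "M3 (addr a i' j') = M2 (addr a i' j')" by (subst M3) (use that in auto)
                then show ?thesis using a2[of a i' j'] a1[of a j' i'] that by simp
              qed
              show "M3 (addr 4 s u) = M (addr 4 s u)" if "s \<le> m" "u \<le> n"
                "\<And>y. k \<le> y \<Longrightarrow> y \<le> L \<Longrightarrow> split_row i j \<le> Suc i - L \<Longrightarrow> s \<noteq> Suc i - y \<or> u \<noteq> Suc j - y" for s u
                using M3[of 4 u s] s2[of u s] a1[of 4 u s] that by simp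
              show "M3 (addr 0 (Suc i) (Suc j)) = opt (Suc i) (Suc j)"
                "M3 (addr 2 (Suc i) (Suc j)) = split_row (Suc i) (Suc j)"
                by (subst M3; use ij in simp)+
              show "M3 (addr 1 (Suc i) (Suc j)) = iso_len (Suc i) (Suc j)"
                using M3[of 1 "Suc j" "Suc i"] ij a2[of 1 "Suc i" "Suc j"] L1(2) unfolding L_def by simp
              show "queue (Suc i) (Suc j) (M3 (addr 3 (Suc i) (Suc j))) (\<lambda>s u. M3 (addr 4 s u))"
                using q M3[of 3 "Suc j" "Suc i"] ij by simp
            qed
            have "M3 (addr a 0 s) = M (addr a 0 s)" if "s \<le> i" "a = 5 \<or> a = 6" for a s
              using that M3[of a s 0] a2[of a 0 s] a1[of a s 0] ij mn by auto
            then show "indices M3 i 0" using ind indices_cong[of i M3 M] by simp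
          qed
          have tm2: "t2 + 21 \<le> t + cost i j" using L1(3) new(4) tm unfolding cost_def L_def by linarith
          show ?thesis
            apply (simp add: r2 base2 ij new(1,2) del: split_row.simps)
            apply (subst conj_assoc[symmetric])
            apply (rule conjI)
            subgoal by (rule fin) (use ij in \<open>simp del: split_row.simps\<close>)
            subgoal using tm2 by simp
            done
        qed
        done
    qed
    done
qed

lemma vc_cell_loop:
  assumes base: "base M" and i: "Suc i \<le> m" and M: "M 8 = Suc i" "M 9 = 1" "M 10 = i"
    and T: "tables M (Suc i) 1" and ind: "indices M i 0"
  shows "vc cell_loop (\<lambda>M' t'. base M' \<and> M' 8 = Suc i \<and> tables M' (Suc (Suc i)) 1 \<and>
      t' \<le> t + (\<Sum>j<n. cost i j + 10) + 2) M t"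
proof -
  define I where "I M' t' \<longleftrightarrow> base M' \<and> M' 8 = Suc i \<and> M' 10 = i \<and> indices M' i 0 \<and>
      1 \<le> M' 9 \<and> M' 9 \<le> n + 1 \<and> tables M' (Suc i) (M' 9) \<and>
      t' \<le> t + (\<Sum>j<M' 9 - 1. cost i j + 10)" for M' t'
  show ?thesis
    unfolding cell_loop_def
  proof (rule vc_WhileI[where I = I and B = "t + (\<Sum>j<n. cost i j + 10)"], goal_cases)
    case 1
    show ?case using base M T ind mn by (simp add: I_def)
  next
    case (2 M' t')
    then have "(\<Sum>j<M' 9 - 1. cost i j + 10) \<le> (\<Sum>j<n. cost i j + 10)"
      unfolding I_def by (intro sum_mono2) auto
    then show ?case using 2 unfolding I_def by linarith
  next
    case (3 M' t')
    then obtain j where j: "M' 9 = Suc j" by (cases "M' 9") (auto simp: I_def)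
    have I: "base M'" "M' 8 = Suc i" "M' 10 = i" "indices M' i 0" "tables M' (Suc i) (Suc j)"
      "t' \<le> t + (\<Sum>j<j. cost i j + 10)"
      using 3(1) unfolding I_def j by auto
    have b: "M' 1 = n" "M' 4 = 1" using I(1) by (auto simp: base_def)
    have jn: "Suc j \<le> n" using 3(2) b j by simp
    have T': "tables (M'(11 := j)) (Suc i) (Suc j)" by (rule tables_cong[OF I(5)]) simp
    show ?case
      apply (simp add: b j)
      apply (rule vc_mono[OF vc_cell[where i = i and j = j]])
               apply (simp_all add: I(1-4) i jn j T')
      subgoal premises p for M'' t''
      proof -
        have b2: "M'' 4 = 1" using p by (simp add: base_def)
        have T2: "tables (M''(9 := Suc (Suc j))) (Suc i) (Suc (Suc j))"
          by (rule tables_cong[of M'']) (use p in simp_all)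
        have w: "Suc (Suc j) < word" using jn by simp
        show ?thesis using p I(6) jn by (simp add: b2 w I_def T2)
      qed
      done
  next
    case (4 M' t')
    then have b: "M' 1 = n" unfolding I_def base_def by blast
    then have "M' 9 = Suc n" using 4 unfolding I_def by simp
    then show ?case using 4(1) tables_next_row[of M' "Suc i"] unfolding I_def by simp
  qed
qed

definition row_cost :: "nat \<Rightarrow> nat" where
  "row_cost i = 80 * i + 100 + (\<Sum>j<n. cost i j + 10)"

lemma vc_row_loop:
  assumes base: "base M" and M: "M 8 = 1" and T: "tables M 1 1"
  shows "vc row_loop (\<lambda>M' t'. base M' \<and> M' (addr 0 m n) = opt m n \<and>
      t' \<le> t + (\<Sum>i<m. row_cost i) + 2) M t"
proof -
  define I where "I M' t' \<longleftrightarrow> base M' \<and> 1 \<le> M' 8 \<and> M' 8 \<le> m + 1 \<and> tables M' (M' 8) 1 \<and>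
      t' \<le> t + (\<Sum>i<M' 8 - 1. row_cost i)" for M' t'
  show ?thesis
    unfolding row_loop_def
  proof (rule vc_WhileI[where I = I and B = "t + (\<Sum>i<m. row_cost i)"], goal_cases)
    case 1
    show ?case using base M T by (simp add: I_def)
  next
    case (2 M' t')
    then have "(\<Sum>i<M' 8 - 1. row_cost i) \<le> (\<Sum>i<m. row_cost i)"
      unfolding I_def by (intro sum_mono2) auto
    then show ?case using 2 unfolding I_def by linarith
  next
    case (3 M' t')
    then obtain i where i: "M' 8 = Suc i" by (cases "M' 8") (auto simp: I_def)
    have I: "base M'" "tables M' (Suc i) 1" "t' \<le> t + (\<Sum>i<i. row_cost i)"
      using 3(1) unfolding I_def i by auto
    have b: "M' 0 = m" "M' 3 = 0" "M' 4 = 1" using I(1) by (auto simp: base_def)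
    have im: "Suc i \<le> m" using 3(2) b i by simp
    show ?case
      apply (simp add: b i)
      apply (rule vc_mono[OF vc_row_indices[where e = i]])
         apply (simp_all add: I(1) im Suc_le_lessD)
      subgoal premises p for M1 t1
      proof -
        have f1: "M1 a = M' a" if "a \<notin> {6, 7, 10} \<union> {14..29}"
          "\<And>s. s \<le> i \<Longrightarrow> a \<noteq> addr 5 0 s \<and> a \<noteq> addr 6 0 s" for a
          using p[THEN conjunct1, rule_format, of a] that by simp
        have M1: "M1 10 = i"
          using p[THEN conjunct1, rule_format, of 10] by simp
        have base1: "base M1" using I(1) unfolding base_def by (simp add: f1)
        have r1: "M1 8 = Suc i" "M1 3 = 0" "M1 4 = 1" using b i by (simp_all add: f1)
        have T1: "tables (M1(9 := Suc 0)) (Suc i) 1"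
          by (rule tables_cong[OF I(2)]) (simp add: f1)
        have ind1: "indices M1 i 0" and t1: "t1 \<le> t' + 3 + 80 * i + 30" using p by auto
        show ?thesis
          apply (simp add: r1)
          apply (rule vc_mono[OF vc_cell_loop[where i = i]])
                 apply (simp_all add: base1 r1 M1 im ind1 T1[simplified])
          subgoal premises q for M2 t2
          proof -
            have b2: "M2 4 = 1" using q by (simp add: base_def)
            have T2: "tables (M2(8 := Suc (Suc i))) (Suc (Suc i)) 1"
              by (rule tables_cong[of M2]) (use q in simp_all)
            have w: "Suc (Suc i) < word" using im by simp
            have "Suc t2 \<le> t + (\<Sum>i<Suc i. row_cost i)"
              using q t1 I(3) by (simp add: row_cost_def)
            then show ?thesis using q im T2 by (simp add: b2 w I_def)
          qed
          done
      qed
      done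
  next
    case (4 M' t')
    then have "M' 0 = m" unfolding I_def base_def by blast
    then have "M' 8 = Suc m" using 4 unfolding I_def by simp
    then show ?case
      using 4(1) tablesD(1)[of M' "Suc m" 1 m n] unfolding I_def by simp
  qed
qed

text \<open>The constant is \<open>80 + 100 + 310 + 2 * 120\<close>: each potential contributes
  \<open>60 * (m * (m + n))\<close>, at most \<open>120 * (m * n)\<close>.\<close>

lemma sum_row_cost_le: "(\<Sum>i<m. row_cost i) \<le> 730 * (m * n)"
proof -
  define f where "f i j = i - iso_len i j" for i j
  have "(\<Sum>i<m. \<Sum>j<n. f (Suc i) (Suc j) - f i j) \<le> m * (m + n)"
  proof (rule sum_diagonal_increments_le)
    show "f i j \<le> f (Suc i) (Suc j)" if "i < m" "j < n" for i j
      using iso_len_Suc_le[of i j] that unfolding f_def by simp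
  qed (auto simp: f_def)
  moreover have "(\<Sum>i<m. \<Sum>j<n. split_row (Suc i) (Suc j) - split_row i j) \<le> m * (m + n)"
  proof (rule sum_diagonal_increments_le)
    show "split_row i j \<le> m" if "i \<le> m" for i j
      using split_row_le[of i j] k1 that by linarith
  qed (rule split_row_Suc_mono)
  moreover have "(\<Sum>i<m. row_cost i) = (\<Sum>i<m. 80 * i) + 100 * m + 310 * (m * n) +
      60 * (\<Sum>i<m. \<Sum>j<n. f (Suc i) (Suc j) - f i j) +
      60 * (\<Sum>i<m. \<Sum>j<n. split_row (Suc i) (Suc j) - split_row i j)"
    by (simp add: row_cost_def cost_def f_def sum.distrib sum_distrib_left del: split_row.simps)
  moreover have "(\<Sum>i<m. 80 * i) \<le> (\<Sum>i<m. 80 * m)" by (intro sum_mono) auto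
  then have "(\<Sum>i<m. 80 * i) \<le> 80 * (m * m)" by simp
  moreover have "m * m \<le> m * n" "m \<le> m * n"
    using mult_le_mono2[OF mn, of m] mult_le_mono2[OF le_trans[OF m1 mn], of m] by auto
  ultimately show ?thesis unfolding distrib_left by linarith
qed

lemma vc_program:
  "vc program (\<lambda>M' t'. M' 0 = opt m n \<and> t' \<le> 760 * (m * n)) (snd (init_config [m, n, k])) 0"
proof -
  define M where "M = snd (init_config [m, n, k])"
  have M: "M 0 = m" "M 1 = n" "M 2 = k" "M 3 = 0" "\<And>a. 64 \<le> a \<Longrightarrow> M a = 0"
    by (auto simp: M_def init_config_def)
  have n1: "1 \<le> m * n" using mult_le_mono[OF m1 le_trans[OF m1 mn]] by simp
  have base: "base (M(4 := Suc 0, 5 := Suc n, 8 := Suc 0))" using M by (simp add: base_def)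
  have T: "tables (M(4 := Suc 0, 5 := Suc n, 8 := Suc 0)) (Suc 0) (Suc 0)"
    using tables_init[of "M(4 := Suc 0, 5 := Suc n, 8 := Suc 0)"] M by simp
  show ?thesis
    unfolding program_def M_def[symmetric]
    using m1
    apply (simp add: M M[simplified])
    apply (rule vc_mono[OF vc_row_loop])
       apply (simp_all add: base T)
    subgoal premises p for M' t'
    proof -
      have "M' 0 = m" "M' 1 = n" "M' 5 = n + 1" using p by (auto simp: base_def)
      moreover have "t' + 7 \<le> 760 * (m * n)" using p sum_row_cost_le n1 by linarith
      ultimately show ?thesis using p by simp
    qed
    done
qed

end


theorem theorem2:
  shows "\<exists>(P::instr list) (c::nat). \<forall>(A::'a set) (r::'a rel) (k::nat) (X::'a list) (Y::'a list) (m::nat) (n::nat).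
    linear_order_on A r \<longrightarrow> k \<ge> 1 \<longrightarrow>
    X \<in> lists A \<longrightarrow> Y \<in> lists A \<longrightarrow> length X = m \<longrightarrow> length Y = n \<longrightarrow> n \<ge> m \<longrightarrow>
    (\<exists>Z. is_op_LCS A r k X Y Z \<and>
         ram_computes P r (X @ Y) [m, n, k] (length Z)
           (c * max 1 (m * n)) (c * max 1 (m * n)) ((m + n + k + 1) ^ c))"
\<comment> \<open>The value 800 exceeds the time factor 760 and the cell count, at most
  \<open>64 + 32 * (m * n)\<close>. As an exponent it suffices because numbers stay below
  \<open>64 * S ^ 2\<close> with \<open>S \<ge> 2\<close>.\<close>
proof (rule exI[of _ "compile program 0"], rule exI[of _ 800], intro allI impI)
  fix A :: "'a set" and r :: "'a rel" and k :: nat and X Y :: "'a list" and m n :: nat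
  assume as: "linear_order_on A r" "k \<ge> 1" "X \<in> lists A" "Y \<in> lists A" "length X = m" "length Y = n" "n \<ge> m"
  interpret op_lcs A r k X Y by unfold_locales (use as in auto)
  obtain Z where Z: "is_op_LCS A r k X Y Z" "length Z = opt m n" using is_op_LCS_opt as by blast
  define S where "S = m + n + k + 1"
  have S: "2 \<le> S" "m + n + k \<le> S" using as by (simp_all add: S_def)
  have SS: "2 * S \<le> S * S" "4 \<le> S * S"
    using mult_le_mono[OF S(1) order_refl, of S] mult_le_mono[OF S(1) S(1)] by simp_all
  have pow: "64 * S ^ 2 \<le> S ^ 800"
  proof -
    have "(2::nat) ^ 6 * S ^ 2 \<le> S ^ 6 * S ^ 2" using S by (intro mult_right_mono power_mono) auto
    also have "\<dots> \<le> S ^ 800" using S by (simp add: power_increasing flip: power_add)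
    finally show ?thesis by simp
  qed
  have "ram_computes (compile program 0) r (X @ Y) [m, n, k] (length Z)
      (800 * max 1 (m * n)) (800 * max 1 (m * n)) (S ^ 800)"
  proof (cases "m = 0")
    case True
    interpret ram r "X @ Y" 64 "128 + n + k" by unfold_locales auto
    have vc: "vc program (\<lambda>M t. M 0 = length Z \<and> t \<le> 10) (snd (init_config [m, n, k])) 0"
      using True Z(2) by (simp add: program_def init_config_def)
    have "128 + n + k \<le> S ^ 800"
    proof -
      have "128 + n + k \<le> 64 * S ^ 2" using SS S unfolding power2_eq_square by linarith
      then show ?thesis using pow by simp
    qed
    then show ?thesis
      by (intro ram_computes_vc[OF vc _ com_ok_program]) (use True in auto)
  next
    case False
    interpret op_lcs_ram A r k X Y by unfold_locales (use as False in auto)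
    have 1: "1 \<le> m" "1 \<le> n" "1 \<le> m * n" using False as mult_le_mono[of 1 m 1 n] by auto
    have mn: "(m + 1) * (n + 1) \<le> 4 * (m * n)"
      using mult_le_mono[of "m + 1" "2 * m" "n + 1" "2 * n"] 1 by simp
    have "cells \<le> 800 * max 1 (m * n)" using mn 1 unfolding cells_def as by simp
    moreover have "word \<le> S ^ 800"
    proof -
      have P: "(m + 1) * (n + 1) \<le> S * S" unfolding S_def by (intro mult_le_mono) auto
      have "128 + (64 + 8 * p) + 8 * y \<le> 64 * q"
        if "p \<le> q" "2 * S \<le> q" "4 \<le> q" "y \<le> S" for p q y :: nat
        using that by linarith
      from this[OF P SS S(2)]
      have "word \<le> 64 * S ^ 2"
        unfolding word_def cells_def as power2_eq_square .
      then show ?thesis using pow by simp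
    qed
    ultimately show ?thesis
      using ram_computes_vc[OF vc_program[unfolded as] _ com_ok_program, of "800 * max 1 (m * n)" "800 * max 1 (m * n)" "S ^ 800"]
        Z(2) 1 as by (simp add: word_gt)
  qed
  then show "\<exists>Z. is_op_LCS A r k X Y Z \<and> ram_computes (compile program 0) r (X @ Y) [m, n, k] (length Z)
      (800 * max 1 (m * n)) (800 * max 1 (m * n)) ((m + n + k + 1) ^ 800)"
    using Z unfolding S_def by blast
qed

end
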